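(* There is a Turing machine $M_{\mathrm{heap}}$ that, given a number $k$ and a closed term $s$, halts in time $O(p(|s|,k))$ for some polynomial $p$ and in space $O(|s|\cdot q(k))$ for some polynomial $q$. If $s$ has a normal form $t$ and $k\ge 4\cdot\mathrm{Time}(s)+2$, it computes a heap $H$ and a closure $g$ such that $g\gg_H t$. Otherwise, it halts in a distinguished final state denoting failure.
   Context: $\mathsf{L}$-terms (de Bruijn): $s::=n\mid st\mid\lambda s$, size $|n|=1+n$, $|\lambda s|=1+|s|$, $|st|=1+|s|+|t|$; closed means no free de Bruijn indices. Substitution $k^k_u=u$, $n^k_u=n$ ($n\ne k$), $(st)^k_u=(s^k_u)(t^k_u)$, $(\lambda s)^k_u=\lambda(s^{k+1}_u)$. Reduction: $(\lambda s)(\lambda t)\succ s^0_{\lambda t}$; $s\succ s'\Rightarrow st\succ s't$; $t\succ t'\Rightarrow(\lambda s)t\succ(\lambda s)t'$. If $s\succ^j t$ with $t$ an abstraction (the normal form), $\mathrm{Time}(s)=j$. Programs are lists of commands $\mathsf{ret},\mathsf{var}\,n,\mathsf{lam},\mathsf{app}$; $\gamma n=[\mathsf{var}\,n]$, $\gamma(st)=\gamma s++\gamma t++[\mathsf{app}]$, $\gamma(\lambda s)=\mathsf{lam}::\gamma s++[\mathsf{ret}]$; terms are stored on tape as $\gamma s$ with unary indices. $P\gg s$ iff $P=\gamma u$ and $s=\lambda u$. A closure is a pair $(P,a)$ of a program and an address $a\in\mathbb N$; a heap entry is a pair $(g,b)$ of a closure and an address; a heap $H$ is a list of entries; $H[a]$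 is the $a$-th entry for $1\le a\le|H|$, undefined otherwise. Lookup: if $H[a]=(g,b)$ then $H[a,0]=g$ and $H[a,n+1]=H[b,n]$; else undefined. Unfolding $\langle s,a\rangle\triangleright^H_k s'$ is inductively defined: $\langle n,a\rangle\triangleright^H_k n$ if $n<k$; $\langle n,a\rangle\triangleright^H_k s'$ if $n\ge k$, $H[a,n-k]=(P,b)$, $P\gg u$, $\langle u,b\rangle\triangleright^H_0 s'$; $\langle\lambda s,a\rangle\triangleright^H_k\lambda s'$ if $\langle s,a\rangle\triangleright^H_{k+1}s'$; $\langle st,a\rangle\triangleright^H_k s't'$ if $\langle s,a\rangle\triangleright^H_k s'$ and $\langle t,a\rangle\triangleright^H_k t'$. $(P,a)\gg_H s$ iff $P\gg u$ and $\langle u,a\rangle\triangleright^H_0 s$ for some $u$. *)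

theory Defs
  imports Main
begin

datatype lterm = Var nat | App lterm lterm | Lam lterm

fun tsize :: "lterm \<Rightarrow> nat" where
  "tsize (Var n) = 1 + n"
| "tsize (Lam s) = 1 + tsize s"
| "tsize (App s t) = 1 + tsize s + tsize t"

fun bound :: "nat \<Rightarrow> lterm \<Rightarrow> bool" where
  "bound k (Var n) = (n < k)"
| "bound k (App s t) = (bound k s \<and> bound k t)"
| "bound k (Lam s) = bound (Suc k) s"

definition closed :: "lterm \<Rightarrow> bool" where
  "closed s \<longleftrightarrow> bound 0 s"

fun subst :: "lterm \<Rightarrow> nat \<Rightarrow> lterm \<Rightarrow> lterm" where
  "subst (Var n) k u = (if n = k then u else Var n)"
| "subst (App s t) k u = App (subst s k u) (subst t k u)"
| "subst (Lam s) k u = Lam (subst s (Suc k) u)"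

fun is_lam :: "lterm \<Rightarrow> bool" where
  "is_lam (Lam _) = True"
| "is_lam _ = False"

inductive step :: "lterm \<Rightarrow> lterm \<Rightarrow> bool" where
  beta: "step (App (Lam s) (Lam t)) (subst s 0 (Lam t))"
| appL: "step s s' \<Longrightarrow> step (App s t) (App s' t)"
| appR: "step t t' \<Longrightarrow> step (App (Lam s) t) (App (Lam s) t')"

definition reduces_in :: "nat \<Rightarrow> lterm \<Rightarrow> lterm \<Rightarrow> bool" where
  "reduces_in j s t \<longleftrightarrow> (step ^^ j) s t \<and> is_lam t"

definition normal_form :: "lterm \<Rightarrow> lterm \<Rightarrow> bool" where
  "normal_form s t \<longleftrightarrow> (\<exists>j. reduces_in j s t)"

definition Time :: "lterm \<Rightarrow> nat" where
  "Time s = (THE j. \<exists>t. reduces_in j s t)"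

datatype cmd = Ret | VarC nat | LamC | AppC

fun gamma :: "lterm \<Rightarrow> cmd list" where
  "gamma (Var n) = [VarC n]"
| "gamma (App s t) = gamma s @ gamma t @ [AppC]"
| "gamma (Lam s) = LamC # gamma s @ [Ret]"

definition prog_rep :: "cmd list \<Rightarrow> lterm \<Rightarrow> bool" where
  "prog_rep P s \<longleftrightarrow> (\<exists>u. P = gamma u \<and> s = Lam u)"

type_synonym clos = "cmd list \<times> nat"
type_synonym heap = "(clos \<times> nat) list"

text \<open>H[a,n]; H[a] is the a-th entry (1-based)\<close>
fun lookup :: "heap \<Rightarrow> nat \<Rightarrow> nat \<Rightarrow> clos option" where
  "lookup H a 0 = (if 1 \<le> a \<and> a \<le> length H then Some (fst (H ! (a - 1))) else None)"
| "lookup H a (Suc n) = (if 1 \<le> a \<and> a \<le> length H then lookup H (snd (H ! (a - 1))) n else None)"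

inductive unfold :: "heap \<Rightarrow> lterm \<Rightarrow> nat \<Rightarrow> nat \<Rightarrow> lterm \<Rightarrow> bool" where
  unf_bound: "n < k \<Longrightarrow> unfold H (Var n) a k (Var n)"
| unf_free: "k \<le> n \<Longrightarrow> lookup H a (n - k) = Some (P, b) \<Longrightarrow> prog_rep P u \<Longrightarrow>
     unfold H u b 0 s' \<Longrightarrow> unfold H (Var n) a k s'"
| unf_lam: "unfold H s a (Suc k) s' \<Longrightarrow> unfold H (Lam s) a k (Lam s')"
| unf_app: "unfold H s a k s' \<Longrightarrow> unfold H t a k t' \<Longrightarrow> unfold H (App s t) a k (App s' t')"

definition clos_rep :: "heap \<Rightarrow> clos \<Rightarrow> lterm \<Rightarrow> bool" where
  "clos_rep H g s \<longleftrightarrow> (\<exists>u. prog_rep (fst g) u \<and> unfold H u (snd g) 0 s)"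

text \<open>Tape symbols are natural numbers, 0 is the blank. A tape (l, r) has the
  cells left of the head in l (nearest first) and the head cell followed by the
  cells to its right in r (an empty r means the head reads a blank).\<close>

type_synonym tape = "nat list \<times> nat list"

datatype move = L | R | N

record TM =
  ntapes :: nat
  states :: "nat set"
  alph   :: "nat set"
  start  :: nat
  acc    :: nat
  rej    :: nat
  delta  :: "nat \<Rightarrow> nat list \<Rightarrow> nat \<times> (nat \<times> move) list"

fun read_tape :: "tape \<Rightarrow> nat" where
  "read_tape (l, []) = 0"
| "read_tape (l, x # r) = x"

fun act :: "nat \<times> move \<Rightarrow> tape \<Rightarrow> tape" where
  "act (w, m) (l, r) =
     (let r' = w # tl r in
      case m of
        N \<Rightarrow> (l, r')
      | R \<Rightarrow> (w # l, tl r)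
      | L \<Rightarrow> (case l of [] \<Rightarrow> ([], 0 # r') | y # l' \<Rightarrow> (l', y # r')))"

type_synonym config = "nat \<times> tape list"

definition halted :: "TM \<Rightarrow> config \<Rightarrow> bool" where
  "halted M c \<longleftrightarrow> fst c = acc M \<or> fst c = rej M"

definition tm_step :: "TM \<Rightarrow> config \<Rightarrow> config" where
  "tm_step M c =
     (let (q, ts) = c; (q', acts) = delta M q (map read_tape ts)
      in (q', map2 act acts ts))"

datatype sym = S0 | S1 | SRet | SVar | SLam | SApp | STick | SSep | SLpar | SComma | SRpar

fun code :: "sym \<Rightarrow> nat" where
  "code S0 = 1" | "code S1 = 2" | "code SRet = 3" | "code SVar = 4" | "code SLam = 5"
| "code SApp = 6" | "code STick = 7" | "code SSep = 8" | "code SLpar = 9"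
| "code SComma = 10" | "code SRpar = 11"

definition wf_tm :: "TM \<Rightarrow> bool" where
  "wf_tm M \<longleftrightarrow>
     1 \<le> ntapes M \<and> finite (states M) \<and> finite (alph M) \<and>
     0 \<in> alph M \<and> range code \<subseteq> alph M \<and>
     start M \<in> states M \<and> acc M \<in> states M \<and> rej M \<in> states M \<and> acc M \<noteq> rej M \<and>
     (\<forall>q \<in> states M - {acc M, rej M}. \<forall>rs. length rs = ntapes M \<longrightarrow> set rs \<subseteq> alph M \<longrightarrow>
        fst (delta M q rs) \<in> states M \<and> length (snd (delta M q rs)) = ntapes M \<and>
        (\<forall>wm \<in> set (snd (delta M q rs)). fst wm \<in> alph M))"

definition runs :: "TM \<Rightarrow> config \<Rightarrow> nat \<Rightarrow> config \<Rightarrow> bool" where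
  "runs M c0 t c \<longleftrightarrow> c = (tm_step M ^^ t) c0 \<and> halted M c \<and>
     (\<forall>i < t. \<not> halted M ((tm_step M ^^ i) c0))"

definition config_size :: "config \<Rightarrow> nat" where
  "config_size c = (\<Sum>tp \<leftarrow> snd c. length (fst tp) + length (snd tp))"

definition space :: "TM \<Rightarrow> config \<Rightarrow> nat \<Rightarrow> nat" where
  "space M c0 t = Max ((\<lambda>i. config_size ((tm_step M ^^ i) c0)) ` {..t})"

definition contains :: "tape \<Rightarrow> nat list \<Rightarrow> bool" where
  "contains tp w \<longleftrightarrow> (\<exists>i j. tp = (replicate i 0, w @ replicate j 0))"

fun enc_num :: "nat \<Rightarrow> sym list" where
  "enc_num n = (if n = 0 then [] else (if n mod 2 = 0 then S0 else S1) # enc_num (n div 2))"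

fun enc_cmd :: "cmd \<Rightarrow> sym list" where
  "enc_cmd Ret = [SRet]"
| "enc_cmd (VarC n) = SVar # replicate n STick"
| "enc_cmd LamC = [SLam]"
| "enc_cmd AppC = [SApp]"

definition enc_prog :: "cmd list \<Rightarrow> sym list" where
  "enc_prog P = concat (map enc_cmd P)"

definition enc_clos :: "clos \<Rightarrow> sym list" where
  "enc_clos g = [SLpar] @ enc_prog (fst g) @ [SComma] @ enc_num (snd g) @ [SRpar]"

definition enc_entry :: "clos \<times> nat \<Rightarrow> sym list" where
  "enc_entry e = [SLpar] @ enc_clos (fst e) @ [SComma] @ enc_num (snd e) @ [SRpar]"

definition enc_heap :: "heap \<Rightarrow> sym list" where
  "enc_heap H = concat (map enc_entry H)"

definition enc_input :: "nat \<Rightarrow> lterm \<Rightarrow> nat list" where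
  "enc_input k s = map code (enc_num k @ [SSep] @ enc_prog (gamma s))"

definition enc_output :: "clos \<Rightarrow> heap \<Rightarrow> nat list" where
  "enc_output g H = map code (enc_clos g @ [SSep] @ enc_heap H)"

definition init_config :: "TM \<Rightarrow> nat list \<Rightarrow> config" where
  "init_config M w = (start M, ([], w) # replicate (ntapes M - 1) ([], []))"

end

(* A weak call-by-value heap machine evaluates a closed term in exactly 4 * Time s + 2 steps: each
   of the j beta steps is one application step, 2 j + 1 closures are pushed, and j + 1 exhausted
   programs are removed.  Hence comparing the number of machine steps with k decides the bound
   exactly.  A term without normal form drives the machine through arbitrarily many steps, because
   the machine is never stuck on programs that unfold to terms.

   The heap machine is implemented by a while-program over stacks, one tape per stack, with the
   heap stored in the output format and with binary addresses.  A heap step scans the heap at most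
   once per skipped environment entry and there are at most k entries, so the whole run takes time
   linear in the size of s for fixed k.  The space bound is therefore a consequence of the time
   bound: a configuration grows by a constant number of cells per step. *)

theory Submission
  imports Defs
begin

section \<open>Stack programs and their compilation to Turing machines\<close>

text \<open>Linearity in the size of \<open>s\<close> is the delicate point. The heap machine only
  splits programs and never builds one, so every program on a stack or in the heap is at most as
  long as the input program. A step allocates at most one entry, so heap length and addresses stay
  at most \<open>k\<close>. The heap then fits into size of \<open>s\<close> times a polynomial in
  \<open>k\<close>, and so does the cost of one step; bounding the length of a binary address by its
  value is good enough.

  The machine is related to terms through unfolding only: substitution is never performed but
  deferred to the environment. A half-reduced application has no program of its own, so small steps
  cannot be simulated one by one. Convergence is therefore proved along a big-step semantics that
  counts beta steps, and divergence needs a separate argument producing arbitrarily long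
  runs.\<close>

text \<open>A stack is a tape with the head on the topmost symbol, in the sense of \<open>contains\<close>.  A push
  therefore takes two machine steps, a move and a write; \<open>Write\<close> is the program state between the
  two and has no big-step semantics.\<close>

datatype 'r com = Skip | Push 'r sym | Write 'r sym | Pop 'r | Seq "'r com" "'r com"
  | Case 'r "sym option \<Rightarrow> 'r com" | While 'r "sym option \<Rightarrow> bool" "'r com"

fun top_of :: "'a list \<Rightarrow> 'a option" where
  "top_of [] = None"
| "top_of (x # xs) = Some x"

text \<open>The number is the exact count of transitions of the compiled machine: each dispatch of
  \<open>Skip\<close>, \<open>Seq\<close>, \<open>Case\<close> or \<open>While\<close> costs one, a
  pop one, a push two.\<close>

inductive bs :: "'r com \<Rightarrow> ('r \<Rightarrow> sym list) \<Rightarrow> nat \<Rightarrow> ('r \<Rightarrow> sym list) \<Rightarrow> bool" where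
  bs_Skip: "bs Skip s 1 s"
| bs_Push: "bs (Push r a) s 2 (s(r := a # s r))"
| bs_Pop: "bs (Pop r) s 1 (s(r := tl (s r)))"
| bs_Seq: "bs c s n s' \<Longrightarrow> bs d s' m s'' \<Longrightarrow> bs (Seq c d) s (Suc (n + m)) s''"
| bs_Case: "bs (f (top_of (s r))) s n s' \<Longrightarrow> bs (Case r f) s (Suc n) s'"
| bs_WhileF: "\<not> p (top_of (s r)) \<Longrightarrow> bs (While r p c) s 1 s"
| bs_WhileT: "p (top_of (s r)) \<Longrightarrow> bs c s n s' \<Longrightarrow> bs (While r p c) s' m s'' \<Longrightarrow>
    bs (While r p c) s (Suc (n + m)) s''"

definition decode :: "nat \<Rightarrow> sym option" where
  "decode x = (if x = 0 then None else Some (inv code x))"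

definition on_tape :: "nat \<Rightarrow> (nat \<Rightarrow> nat \<times> move) \<Rightarrow> nat list \<Rightarrow> (nat \<times> move) list" where
  "on_tape i f rs = map (\<lambda>j. if j = i then f (rs ! j) else (rs ! j, N)) [0..<length rs]"

definition no_op :: "nat list \<Rightarrow> (nat \<times> move) list" where
  "no_op rs = map (\<lambda>x. (x, N)) rs"

text \<open>A pop blanks the cell that it leaves, because \<open>contains\<close> demands that
  everything to the left of the head be blank.\<close>

fun next_cont :: "('r \<Rightarrow> nat) \<Rightarrow> 'r com list \<Rightarrow> nat list \<Rightarrow> 'r com list \<times> (nat \<times> move) list" where
  "next_cont ix [] rs = ([], no_op rs)"
| "next_cont ix (Skip # K) rs = (K, no_op rs)"
| "next_cont ix (Push r a # K) rs = (Write r a # K, on_tape (ix r) (\<lambda>x. (x, L)) rs)"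
| "next_cont ix (Write r a # K) rs = (K, on_tape (ix r) (\<lambda>x. (code a, N)) rs)"
| "next_cont ix (Pop r # K) rs = (K, on_tape (ix r) (\<lambda>x. (0, R)) rs)"
| "next_cont ix (Seq c d # K) rs = (c # d # K, no_op rs)"
| "next_cont ix (Case r f # K) rs = (f (decode (rs ! ix r)) # K, no_op rs)"
| "next_cont ix (While r p c # K) rs =
    (if p (decode (rs ! ix r)) then c # While r p c # K else K, no_op rs)"

text \<open>The control states of the compiled machine are continuations, that is, lists of programs that
  remain to be run.  Only finitely many of them arise from a given program.\<close>

primrec conts :: "'r com \<Rightarrow> 'r com list \<Rightarrow> 'r com list set" where
  "conts Skip K = {Skip # K}"
| "conts (Push r a) K = {Push r a # K, Write r a # K}"
| "conts (Write r a) K = {Write r a # K}"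
| "conts (Pop r) K = {Pop r # K}"
| "conts (Seq c d) K = insert (Seq c d # K) (conts c (d # K) \<union> conts d K)"
| "conts (Case r f) K = insert (Case r f # K) (\<Union>x. conts (f x) K)"
| "conts (While r p c) K = insert (While r p c # K) (conts c (While r p c # K))"

lemma UNIV_sym: "UNIV = {S0, S1, SRet, SVar, SLam, SApp, STick, SSep, SLpar, SComma, SRpar}"
proof -
  have "x \<in> {S0, S1, SRet, SVar, SLam, SApp, STick, SSep, SLpar, SComma, SRpar}" for x
    by (cases x) auto
  then show ?thesis by blast
qed

instance sym :: finite
  by standard (simp add: UNIV_sym)

lemma inj_code: "inj code"
proof (rule injI)
  fix x y show "code x = code y \<Longrightarrow> x = y"
    by (cases x; cases y) auto
qed

lemma code_nonzero [simp]: "code x \<noteq> 0"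
  by (cases x) auto

lemma decode_0 [simp]: "decode 0 = None"
  by (simp add: decode_def)

lemma decode_code [simp]: "decode (code x) = Some x"
  by (simp add: decode_def inj_code)

lemma finite_conts: "finite (conts c K)"
  by (induction c arbitrary: K) (simp_all add: finite_UN_I)

lemma Cons_in_conts: "c # K \<in> conts c K"
  by (cases c) auto

text \<open>A subprogram runs either inside its own set of continuations or ends in its rest
  \<open>K\<close>. The rest of a loop body is the loop itself, so iterating creates no new
  states.\<close>

lemma next_cont_closed: "x \<in> conts c K \<Longrightarrow> fst (next_cont ix x rs) \<in> insert K (conts c K)"
proof (induction c arbitrary: K)
  case (Seq c d)
  then show ?case
    using Cons_in_conts[of c "d # K"] Cons_in_conts[of d K] by fastforce
next
  case (Case r f)
  then show ?case
    using Cons_in_conts[of "f (decode (rs ! ix r))" K] by fastforce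
next
  case (While r p c)
  then show ?case
    using Cons_in_conts[of c "While r p c # K"] by fastforce
qed auto

lemma next_cont_acts:
  "length (snd (next_cont ix K rs)) = length rs \<and>
   fst ` set (snd (next_cont ix K rs)) \<subseteq> insert 0 (range code) \<union> set rs"
  by (cases "(ix, K, rs)" rule: next_cont.cases) (auto simp: no_op_def on_tape_def)

section \<open>Simulation of stack programs on tapes\<close>

definition cont_step :: "('r \<Rightarrow> nat) \<Rightarrow> 'r com list \<times> tape list \<Rightarrow> 'r com list \<times> tape list" where
  "cont_step ix x = (let (K, acts) = next_cont ix (fst x) (map read_tape (snd x))
     in (K, map2 act acts (snd x)))"

text \<open>Steps start only from nonempty continuations, since at \<open>[]\<close> the compiled
  machine does not follow \<open>next_cont\<close> but delivers its verdict.\<close>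

inductive reach :: "('r \<Rightarrow> nat) \<Rightarrow> 'r com list \<times> tape list \<Rightarrow> nat \<Rightarrow> 'r com list \<times> tape list \<Rightarrow> bool"
  for ix where
  reach_0: "reach ix x 0 x"
| reach_Suc: "K \<noteq> [] \<Longrightarrow> reach ix (cont_step ix (K, ts)) n y \<Longrightarrow> reach ix (K, ts) (Suc n) y"

lemma reach_trans: "reach ix x n y \<Longrightarrow> reach ix y m z \<Longrightarrow> reach ix x (n + m) z"
  by (induction rule: reach.induct) (auto intro: reach.intros)

lemma reach_1: "K \<noteq> [] \<Longrightarrow> cont_step ix (K, ts) = y \<Longrightarrow> reach ix (K, ts) 1 y"
  using reach_Suc[OF _ reach_0] by fastforce

lemma read_tape_contains:
  assumes "contains tp (map code xs)"
  shows "decode (read_tape tp) = top_of xs"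
proof -
  obtain i j where tp: "tp = (replicate i 0, map code xs @ replicate j 0)"
    using assms by (auto simp: contains_def)
  show ?thesis
    by (cases xs; cases j) (auto simp: tp)
qed

text \<open>Rewriting the symbol just read may still change the tape: on an empty right part it
  materialises a blank. The trailing blanks of \<open>contains\<close> absorb it.\<close>

lemma act_no_op_contains:
  assumes "contains tp w"
  shows "contains (act (read_tape tp, N) tp) w"
proof -
  obtain i j where tp: "tp = (replicate i 0, w @ replicate j 0)"
    using assms by (auto simp: contains_def)
  show ?thesis
  proof (cases w)
    case Nil
    have "contains (replicate i 0, 0 # tl (replicate j 0)) []"
      unfolding contains_def by (intro exI[of _ i] exI[of _ "Suc (j - 1)"]) simp
    then show ?thesis by (cases j) (simp_all add: tp Nil)
  qed (auto simp: tp contains_def)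
qed

lemma act_pop_contains:
  assumes "contains tp (map code xs)"
  shows "contains (act (0, R) tp) (map code (tl xs))"
proof -
  obtain i j where tp: "tp = (replicate i 0, map code xs @ replicate j 0)"
    using assms by (auto simp: contains_def)
  have "act (0, R) tp = (replicate (Suc i) 0,
      map code (tl xs) @ replicate (if xs = [] then j - 1 else j) 0)"
    by (cases xs) (simp_all add: tp)
  then show ?thesis unfolding contains_def by blast
qed

lemma act_push_contains:
  assumes "contains tp w"
  shows "contains (act (x, N) (act (read_tape tp, L) tp)) (x # w)"
proof -
  obtain i j where tp: "tp = (replicate i 0, w @ replicate j 0)"
    using assms by (auto simp: contains_def)
  define r where "r = read_tape tp # tl (w @ replicate j 0)"
  have r: "\<exists>j'. r = w @ replicate j' 0"
  proof (cases w)
    case Nil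
    have "r = replicate (Suc (j - 1)) 0"
      by (cases j) (simp_all add: r_def tp Nil)
    then show ?thesis unfolding Nil append_Nil by blast
  qed (auto simp: r_def tp)
  \<comment> \<open>\<open>i - 1\<close> also covers \<open>i = 0\<close>, where moving left creates
    a fresh blank cell.\<close>
  have "act (x, N) (act (read_tape tp, L) tp) = (replicate (i - 1) 0, x # r)"
    by (cases i) (simp_all add: tp r_def)
  then show ?thesis using r by (auto simp: contains_def)
qed

definition tapes_hold :: "('r \<Rightarrow> nat) \<Rightarrow> nat \<Rightarrow> ('r \<Rightarrow> sym list) \<Rightarrow> tape list \<Rightarrow> bool" where
  "tapes_hold ix nt s ts \<longleftrightarrow>
     length ts = nt \<and> (\<forall>r. ix r < nt \<and> contains (ts ! ix r) (map code (s r)))"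

lemma tapes_hold_no_op:
  assumes "tapes_hold ix nt s ts"
  shows "tapes_hold ix nt s (map2 act (no_op (map read_tape ts)) ts)"
  using assms by (auto simp: tapes_hold_def no_op_def intro!: act_no_op_contains)

lemma decode_nth_tapes_hold:
  assumes "tapes_hold ix nt s ts"
  shows "decode (map read_tape ts ! ix r) = top_of (s r)"
  using assms by (auto simp: tapes_hold_def intro!: read_tape_contains)

lemma tapes_hold_push:
  assumes "inj ix" "tapes_hold ix nt s ts"
    and ts': "ts' = map2 act (on_tape (ix r) (\<lambda>x. (x, L)) (map read_tape ts)) ts"
  shows "tapes_hold ix nt (s(r := a # s r))
    (map2 act (on_tape (ix r) (\<lambda>x. (code a, N)) (map read_tape ts')) ts')"
  using assms(1,2) by (auto simp: tapes_hold_def on_tape_def ts' inj_eq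
      intro!: act_no_op_contains act_push_contains)

lemma tapes_hold_pop:
  assumes "inj ix" "tapes_hold ix nt s ts"
  shows "tapes_hold ix nt (s(r := tl (s r)))
    (map2 act (on_tape (ix r) (\<lambda>x. (0, R)) (map read_tape ts)) ts)"
  using assms by (auto simp: tapes_hold_def on_tape_def inj_eq
      intro!: act_no_op_contains act_pop_contains)

text \<open>The rest \<open>K\<close> is arbitrary so that the induction hypotheses apply to
  subprograms, whose rest is longer than that of the whole program.\<close>

lemma bs_reach:
  assumes "inj ix"
  shows "bs c s n s' \<Longrightarrow> tapes_hold ix nt s ts \<Longrightarrow>
    \<exists>ts'. tapes_hold ix nt s' ts' \<and> reach ix (c # K, ts) n (K, ts')"
proof (induction arbitrary: K ts rule: bs.induct)
  case (bs_Skip s)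
  have "reach ix (Skip # K, ts) 1 (K, map2 act (no_op (map read_tape ts)) ts)"
    by (rule reach_1) (simp_all add: cont_step_def)
  then show ?case
    using tapes_hold_no_op[OF bs_Skip] by blast
next
  case (bs_Push r a s)
  define ts1 where "ts1 = map2 act (on_tape (ix r) (\<lambda>x. (x, L)) (map read_tape ts)) ts"
  have 1: "reach ix (Push r a # K, ts) 1 (Write r a # K, ts1)"
    by (rule reach_1) (simp_all add: cont_step_def ts1_def)
  have 2: "reach ix (Write r a # K, ts1) 1
      (K, map2 act (on_tape (ix r) (\<lambda>x. (code a, N)) (map read_tape ts1)) ts1)"
    by (rule reach_1) (simp_all add: cont_step_def)
  show ?case
    using reach_trans[OF 1 2] tapes_hold_push[OF assms bs_Push ts1_def]
    unfolding one_add_one by blast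
next
  case (bs_Pop r s)
  have "reach ix (Pop r # K, ts) 1 (K, map2 act (on_tape (ix r) (\<lambda>x. (0, R)) (map read_tape ts)) ts)"
    by (rule reach_1) (simp_all add: cont_step_def)
  then show ?case
    using tapes_hold_pop[OF assms bs_Pop] by blast
next
  case (bs_Seq c s n s' d m s'')
  define ts1 where "ts1 = map2 act (no_op (map read_tape ts)) ts"
  have 1: "reach ix (Seq c d # K, ts) 1 (c # d # K, ts1)"
    by (rule reach_1) (simp_all add: cont_step_def ts1_def)
  obtain ts2 where 2: "tapes_hold ix nt s' ts2" "reach ix (c # d # K, ts1) n (d # K, ts2)"
    using bs_Seq.IH(1) tapes_hold_no_op[OF bs_Seq.prems] ts1_def by blast
  obtain ts3 where 3: "tapes_hold ix nt s'' ts3" "reach ix (d # K, ts2) m (K, ts3)"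
    using bs_Seq.IH(2) 2 by blast
  show ?case
    using reach_trans[OF 1 reach_trans[OF 2(2) 3(2)]] 3(1) by auto
next
  case (bs_Case f s r n s')
  define ts1 where "ts1 = map2 act (no_op (map read_tape ts)) ts"
  have 1: "reach ix (Case r f # K, ts) 1 (f (top_of (s r)) # K, ts1)"
    by (rule reach_1)
      (simp_all add: cont_step_def ts1_def decode_nth_tapes_hold[OF bs_Case.prems])
  obtain ts2 where 2: "tapes_hold ix nt s' ts2" "reach ix (f (top_of (s r)) # K, ts1) n (K, ts2)"
    using bs_Case.IH tapes_hold_no_op[OF bs_Case.prems] ts1_def by blast
  show ?case
    using reach_trans[OF 1 2(2)] 2(1) by auto
next
  case (bs_WhileF p s r c)
  then have "reach ix (While r p c # K, ts) 1 (K, map2 act (no_op (map read_tape ts)) ts)"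
    by (intro reach_1)
      (simp_all add: cont_step_def decode_nth_tapes_hold[OF bs_WhileF.prems])
  then show ?case
    using tapes_hold_no_op[OF bs_WhileF.prems] by blast
next
  case (bs_WhileT p s r c n s' m s'')
  define ts1 where "ts1 = map2 act (no_op (map read_tape ts)) ts"
  have 1: "reach ix (While r p c # K, ts) 1 (c # While r p c # K, ts1)"
    using bs_WhileT.hyps(1) by (intro reach_1)
      (simp_all add: cont_step_def ts1_def decode_nth_tapes_hold[OF bs_WhileT.prems])
  obtain ts2 where 2: "tapes_hold ix nt s' ts2"
    "reach ix (c # While r p c # K, ts1) n (While r p c # K, ts2)"
    using bs_WhileT.IH(1) tapes_hold_no_op[OF bs_WhileT.prems] ts1_def by blast
  obtain ts3 where 3: "tapes_hold ix nt s'' ts3" "reach ix (While r p c # K, ts2) m (K, ts3)"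
    using bs_WhileT.IH(2) 2 by blast
  show ?case
    using reach_trans[OF 1 reach_trans[OF 2(2) 3(2)]] 3(1) by auto
qed

text \<open>State 0 accepts and state 1 rejects; the continuation \<open>K\<close> is the state \<open>e K + 2\<close>.  The empty
  continuation reads the verdict off the stack \<open>fl\<close>.\<close>

definition compile :: "('r com list \<Rightarrow> nat) \<Rightarrow> ('r \<Rightarrow> nat) \<Rightarrow> nat \<Rightarrow> 'r \<Rightarrow> 'r com \<Rightarrow> TM" where
  "compile e ix nt fl c =
    (let S = insert [] (conts c []) in
     \<lparr>ntapes = nt, states = {0, 1} \<union> (\<lambda>K. e K + 2) ` S, alph = insert 0 (range code),
      start = e [c] + 2, acc = 0, rej = 1,
      delta = (\<lambda>q rs.
        let K = inv_into S e (q - 2) in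
        if K = [] then (if decode (rs ! ix fl) = Some S1 then 0 else 1, no_op rs)
        else (let (K', acts) = next_cont ix K rs in (e K' + 2, acts)))\<rparr>)"

section \<open>Correctness of the compiled machine\<close>

lemma compile_simps [simp]:
  "ntapes (compile e ix nt fl c) = nt" "acc (compile e ix nt fl c) = 0"
  "rej (compile e ix nt fl c) = 1" "start (compile e ix nt fl c) = e [c] + 2"
  by (simp_all add: compile_def Let_def)

lemma delta_compile:
  assumes "inj_on e (insert [] (conts c []))" "K \<in> insert [] (conts c [])"
  shows "delta (compile e ix nt fl c) (e K + 2) rs =
    (if K = [] then (if decode (rs ! ix fl) = Some S1 then 0 else 1, no_op rs)
     else (e (fst (next_cont ix K rs)) + 2, snd (next_cont ix K rs)))"
proof -
  have "inv_into (insert [] (conts c [])) e (e K) = K"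
    using assms by (rule inv_into_f_f)
  then show ?thesis by (simp add: compile_def Let_def case_prod_unfold del: inj_on_insert)
qed

lemma next_cont_closed':
  assumes "K \<in> insert [] (conts c [])"
  shows "fst (next_cont ix K rs) \<in> insert [] (conts c [])"
  using assms next_cont_closed[of K c "[]"] by auto

lemma wf_compile:
  fixes ix :: "'r \<Rightarrow> nat" and c :: "'r com"
  assumes inj: "inj_on e (insert [] (conts c []))" and "1 \<le> nt"
  shows "wf_tm (compile e ix nt fl c)"
proof -
  let ?M = "compile e ix nt fl c" and ?S = "insert [] (conts c [])"
  have st: "states ?M = {0, 1} \<union> (\<lambda>K. e K + 2) ` ?S"
    and al: "alph ?M = insert 0 (range code)"
    by (auto simp: compile_def Let_def)
  have valid: "fst (delta ?M q rs) \<in> states ?M \<and> length (snd (delta ?M q rs)) = nt \<and>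
      (\<forall>wm \<in> set (snd (delta ?M q rs)). fst wm \<in> alph ?M)"
    if q: "q \<in> states ?M - {0, 1}" and rs: "length rs = nt" "set rs \<subseteq> alph ?M" for q rs
  proof -
    obtain K where K: "K \<in> ?S" "q = e K + 2"
      using q by (auto simp: st)
    show ?thesis
      using rs next_cont_closed'[OF K(1), of ix rs] next_cont_acts[of ix K rs]
      unfolding K(2) delta_compile[OF inj K(1)] al st
      by (auto simp: no_op_def)
  qed
  have "finite (states ?M)" "finite (alph ?M)" "0 \<in> alph ?M" "range code \<subseteq> alph ?M"
    "e [c] + 2 \<in> states ?M" "0 \<in> states ?M" "1 \<in> states ?M" "(0 :: nat) \<noteq> 1"
    using Cons_in_conts[of c "[]"] by (auto simp: st al finite_conts)
  then show ?thesis
    using assms(2) valid unfolding wf_tm_def compile_simps by blast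
qed

lemma tm_step_compile:
  assumes "inj_on e (insert [] (conts c []))" "K \<in> insert [] (conts c [])" "K \<noteq> []"
    "cont_step ix (K, ts) = (K', ts')"
  shows "tm_step (compile e ix nt fl c) (e K + 2, ts) = (e K' + 2, ts')"
  using assms(3,4) delta_compile[OF assms(1,2), of ix nt fl "map read_tape ts"]
  by (auto simp: tm_step_def cont_step_def case_prod_unfold Let_def)

text \<open>Continuation states are at least 2 and hence differ from the halting states 0 and 1.
  This includes the state of \<open>[]\<close> after \<open>n\<close> steps; halting takes one
  further step.\<close>

lemma compile_reach:
  assumes inj: "inj_on e (insert [] (conts c []))"
  shows "reach ix x n y \<Longrightarrow> fst x \<in> insert [] (conts c []) \<Longrightarrow> fst y = [] \<Longrightarrow>
    (tm_step (compile e ix nt fl c) ^^ n) (e (fst x) + 2, snd x) = (e [] + 2, snd y) \<and>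
    (\<forall>i \<le> n. \<not> halted (compile e ix nt fl c)
      ((tm_step (compile e ix nt fl c) ^^ i) (e (fst x) + 2, snd x)))"
proof (induction rule: reach.induct)
  case (reach_0 x)
  then show ?case by (simp add: halted_def)
next
  case (reach_Suc K ts n y)
  let ?M = "compile e ix nt fl c"
  obtain K' ts' where x': "cont_step ix (K, ts) = (K', ts')"
    by fastforce
  have K': "K' = fst (next_cont ix K (map read_tape ts))"
    using x' by (simp add: cont_step_def case_prod_unfold Let_def)
  have K'S: "K' \<in> insert [] (conts c [])"
    unfolding K' using reach_Suc.prems(1) by (intro next_cont_closed') simp
  have step1: "tm_step ?M (e K + 2, ts) = (e K' + 2, ts')"
    using tm_step_compile[OF inj _ reach_Suc.hyps(1) x'] reach_Suc.prems(1) by simp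
  have IH: "(tm_step ?M ^^ n) (e K' + 2, ts') = (e [] + 2, snd y) \<and>
      (\<forall>i \<le> n. \<not> halted ?M ((tm_step ?M ^^ i) (e K' + 2, ts')))"
    using reach_Suc.IH K'S reach_Suc.prems(2) by (simp add: x')
  have "\<not> halted ?M ((tm_step ?M ^^ i) (e K + 2, ts))" if "i \<le> Suc n" for i
  proof (cases i)
    case 0
    then show ?thesis by (simp add: halted_def)
  next
    case (Suc i')
    then have "(tm_step ?M ^^ i) (e K + 2, ts) = (tm_step ?M ^^ i') (e K' + 2, ts')"
      by (simp only: funpow_Suc_right comp_apply step1)
    then show ?thesis
      using IH that Suc by simp
  qed
  then show ?case
    using IH unfolding funpow_Suc_right comp_apply fst_conv snd_conv step1 by blast
qed

text \<open>The input stack must have index 0, where \<open>init_config\<close> puts the input. The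
  extra step in \<open>Suc n\<close> is the verdict read off \<open>fl\<close>.\<close>

theorem compile_runs:
  assumes inj: "inj_on e (insert [] (conts c []))" and ix: "inj ix" "range ix = {..<nt}"
    and r0: "ix r0 = 0" and bs: "bs c ((\<lambda>_. [])(r0 := w)) n s'"
  shows "\<exists>cf. runs (compile e ix nt fl c) (init_config (compile e ix nt fl c) (map code w)) (Suc n) cf \<and>
    fst cf = (if top_of (s' fl) = Some S1 then acc (compile e ix nt fl c) else rej (compile e ix nt fl c)) \<and>
    (\<forall>r. contains (snd cf ! ix r) (map code (s' r)))"
proof -
  let ?M = "compile e ix nt fl c"
  define ts0 :: "tape list" where "ts0 = ([], map code w) # replicate (nt - 1) ([], [])"
  have lt: "ix r < nt" for r
    using ix(2) by blast
  have init: "init_config ?M (map code w) = (e [c] + 2, ts0)"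
    by (simp add: init_config_def ts0_def)
  have "contains (ts0 ! ix r) (map code (((\<lambda>_. [])(r0 := w)) r))" for r
  proof (cases "r = r0")
    case True
    then show ?thesis by (auto simp: ts0_def r0 contains_def)
  next
    case False
    then have "ix r \<noteq> 0"
      using r0 ix(1) by (metis injD)
    then show ?thesis
      using False lt[of r] by (auto simp: ts0_def contains_def nth_Cons')
  qed
  moreover have "length ts0 = nt"
    using lt[of r0] by (simp add: ts0_def)
  ultimately have "tapes_hold ix nt ((\<lambda>_. [])(r0 := w)) ts0"
    using lt by (simp add: tapes_hold_def)
  then obtain ts1 where ts1: "tapes_hold ix nt s' ts1" "reach ix ([c], ts0) n ([], ts1)"
    using bs_reach[OF ix(1) bs] by blast
  let ?ts2 = "map2 act (no_op (map read_tape ts1)) ts1"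
  let ?q = "if top_of (s' fl) = Some S1 then 0 else 1"
  have run: "(tm_step ?M ^^ n) (e [c] + 2, ts0) = (e [] + 2, ts1)"
    "\<forall>i \<le> n. \<not> halted ?M ((tm_step ?M ^^ i) (e [c] + 2, ts0))"
    using compile_reach[OF inj ts1(2)] Cons_in_conts[of c "[]"] by auto
  have last: "tm_step ?M (e [] + 2, ts1) = (?q, ?ts2)"
    using delta_compile[OF inj, of "[]" ix nt fl "map read_tape ts1"]
    by (simp add: tm_step_def decode_nth_tapes_hold[OF ts1(1)])
  have "runs ?M (init_config ?M (map code w)) (Suc n) (?q, ?ts2)"
    using run last by (auto simp: runs_def init halted_def)
  moreover have "\<forall>r. contains (?ts2 ! ix r) (map code (s' r))"
    using tapes_hold_no_op[OF ts1(1)] unfolding tapes_hold_def by blast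
  ultimately show ?thesis
    by (intro exI[of _ "(?q, ?ts2)"] conjI) simp_all
qed

text \<open>Growth by 2 is attained by a left move on a tape with no cells: one cell is written and
  one blank is created.\<close>

lemma length_act: "length (fst (act a tp)) + length (snd (act a tp)) \<le>
    length (fst tp) + length (snd tp) + 2"
  by (cases a; cases tp; cases "snd a") (auto simp: Let_def split: list.split)

lemma config_size_tm_step: "config_size (tm_step M c) \<le> config_size c + 2 * length (snd c)
    \<and> length (snd (tm_step M c)) \<le> length (snd c)"
proof -
  have "(\<Sum>tp \<leftarrow> map2 act as ts. length (fst tp) + length (snd tp)) \<le>
      (\<Sum>tp \<leftarrow> ts. length (fst tp) + length (snd tp)) + 2 * length ts" for as ts
  proof (induction ts arbitrary: as)
    case (Cons tp ts)
    then show ?case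
    proof (cases as)
      case (Cons a as')
      then show ?thesis
        using Cons.IH[of as'] length_act[of a tp] by simp
    qed simp
  qed simp
  then show ?thesis
    by (simp add: tm_step_def config_size_def case_prod_unfold Let_def)
qed

lemma config_size_funpow:
  "config_size ((tm_step M ^^ i) c) \<le> config_size c + i * (2 * length (snd c)) \<and>
   length (snd ((tm_step M ^^ i) c)) \<le> length (snd c)"
proof (induction i)
  case (Suc i)
  then show ?case
    using config_size_tm_step[where c = "(tm_step M ^^ i) c" and M = M] by auto
qed simp

lemma space_le_time:
  "space M (init_config M w) t \<le> length w + t * (2 * Suc (ntapes M - 1))"
proof -
  let ?c = "init_config M w"
  have c: "config_size ?c = length w" "length (snd ?c) = Suc (ntapes M - 1)"
    by (simp_all add: config_size_def init_config_def sum_list_replicate)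
  have "config_size ((tm_step M ^^ i) ?c) \<le> length w + t * (2 * Suc (ntapes M - 1))" if "i \<le> t" for i
  proof -
    have "i * (2 * Suc (ntapes M - 1)) \<le> t * (2 * Suc (ntapes M - 1))"
      using that by (rule mult_le_mono1)
    then show ?thesis
      using config_size_funpow[where M = M and i = i and c = ?c] unfolding c by linarith
  qed
  then show ?thesis
    unfolding space_def by (intro Max.boundedI) auto
qed

section \<open>Big-step evaluation and unfolding\<close>

text \<open>The heap machine also evaluates operator, operand and instantiated body in this order,
  so its runs can be composed along the premises. The number counts beta steps and thus agrees with
  \<open>Time\<close>.\<close>

inductive eval :: "lterm \<Rightarrow> nat \<Rightarrow> lterm \<Rightarrow> bool" where
  eval_Lam: "eval (Lam s) 0 (Lam s)"
| eval_App: "eval s i (Lam u) \<Longrightarrow> eval t j (Lam v) \<Longrightarrow> eval (subst u 0 (Lam v)) m w \<Longrightarrow>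
    eval (App s t) (Suc (i + j + m)) w"

inductive_cases eval_LamE: "eval (Lam s) j t"
inductive_cases eval_AppE: "eval (App s t) j w"

lemma eval_is_lam: "eval s j t \<Longrightarrow> \<exists>u. t = Lam u"
  by (induction rule: eval.induct) auto

lemma eval_det: "eval s j t \<Longrightarrow> eval s j' t' \<Longrightarrow> j = j' \<and> t = t'"
proof (induction arbitrary: j' t' rule: eval.induct)
  case (eval_Lam s)
  then show ?case by (auto elim: eval_LamE)
next
  case (eval_App s i u t j v m w)
  from eval_App.prems show ?case
    by (rule eval_AppE) (use eval_App.IH in fastforce)
qed

lemma steps_appL: "(step ^^ n) s s' \<Longrightarrow> (step ^^ n) (App s t) (App s' t)"
  by (induction n arbitrary: s') (auto intro: step.appL)

lemma steps_appR: "(step ^^ n) t t' \<Longrightarrow> (step ^^ n) (App (Lam s) t) (App (Lam s) t')"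
  by (induction n arbitrary: t') (auto intro: step.appR)

lemma eval_steps: "eval s j t \<Longrightarrow> (step ^^ j) s t"
proof (induction rule: eval.induct)
  case (eval_App s i u t j v m w)
  have "(step ^^ (i + (j + (1 + m)))) (App s t) w"
    unfolding relpowp_add
    using steps_appL[OF eval_App.IH(1)] steps_appR[OF eval_App.IH(2)] step.beta[of u v]
      eval_App.IH(3) by fastforce
  then show ?case by (simp add: add_ac)
qed simp

lemma step_eval: "step s s' \<Longrightarrow> eval s' j t \<Longrightarrow> eval s (Suc j) t"
proof (induction arbitrary: j t rule: step.induct)
  case (beta s u)
  then show ?case using eval_App[OF eval_Lam eval_Lam] by fastforce
next
  case (appL s s' u)
  from appL.prems show ?case
    by (rule eval_AppE) (use eval_App[OF appL.IH] in fastforce)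
next
  case (appR u u' s)
  from appR.prems show ?case
    by (rule eval_AppE) (use eval_App[OF _ appR.IH] in fastforce)
qed

lemma steps_eval: "(step ^^ j) s (Lam u) \<Longrightarrow> eval s j (Lam u)"
proof (induction j arbitrary: s)
  case 0
  then show ?case by (simp add: eval_Lam)
next
  case (Suc j)
  then show ?case using step_eval by (metis relpowp_Suc_D2)
qed

lemma reduces_in_iff_eval: "reduces_in j s t \<longleftrightarrow> eval s j t"
proof
  assume "reduces_in j s t"
  then show "eval s j t"
    by (cases t) (auto simp: reduces_in_def intro: steps_eval)
next
  assume "eval s j t"
  then show "reduces_in j s t"
    using eval_steps eval_is_lam by (fastforce simp: reduces_in_def)
qed

lemma Time_eval: "eval s j t \<Longrightarrow> Time s = j"
  unfolding Time_def reduces_in_iff_eval using eval_det by blast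

lemma bound_mono: "bound k s \<Longrightarrow> k \<le> k' \<Longrightarrow> bound k' s"
  by (induction s arbitrary: k k') auto

lemma subst_bound: "bound k s \<Longrightarrow> k \<le> m \<Longrightarrow> subst s m u = s"
  by (induction s arbitrary: k m) auto

lemma unfold_bound: "unfold H s a k s' \<Longrightarrow> bound k s'"
  by (induction rule: unfold.induct) (auto intro: bound_mono)

lemma bound_unfold: "bound k s \<Longrightarrow> unfold H s a k s"
  by (induction s arbitrary: k) (auto intro: unfold.intros)

lemma lookup_append: "lookup H a n = Some g \<Longrightarrow> lookup (H @ H') a n = Some g"
  by (induction H a n rule: lookup.induct) (auto split: if_splits simp: nth_append)

lemma unfold_append: "unfold H s a k s' \<Longrightarrow> unfold (H @ H') s a k s'"
  by (induction rule: unfold.induct) (auto intro: unfold.intros lookup_append)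

lemma clos_rep_append: "clos_rep H g s \<Longrightarrow> clos_rep (H @ H') g s"
  by (auto simp: clos_rep_def intro: unfold_append)

text \<open>Allocation implements substitution: if the entry at \<open>c\<close> extends environment
  \<open>b\<close> by \<open>g\<close>, then from \<open>c\<close> index \<open>k\<close> finds
  \<open>g\<close>, while a larger index skips one entry and continues from \<open>b\<close> as
  before.\<close>

lemma unfold_subst:
  assumes unf: "unfold H s b (Suc k) s'"
    and c: "1 \<le> c" "c \<le> length H" "H ! (c - 1) = (g, b)" and g: "clos_rep H g w"
  shows "unfold H s c k (subst s' k w)"
  using unf c g
proof (induction H s b "Suc k" s' arbitrary: k rule: unfold.induct)
  case (unf_bound n H b)
  show ?case
  proof (cases "n = k")
    case True
    obtain P d where gP: "g = (P, d)"
      by fastforce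
    obtain u where u: "prog_rep P u" "unfold H u d 0 w"
      using unf_bound.prems(4) by (auto simp: clos_rep_def gP)
    have "lookup H c (k - k) = Some (P, d)"
      using unf_bound.prems gP by simp
    then show ?thesis
      using unf_free[OF order_refl _ u] True by simp
  next
    case False
    then show ?thesis
      using unf_bound.hyps by (simp add: unfold.unf_bound)
  qed
next
  case (unf_free n H b P b' u s')
  have "lookup H c (n - k) = Some (P, b')"
    using unf_free.hyps(1,2) unf_free.prems by (simp add: Suc_diff_le flip: Suc_diff_Suc)
  then have "unfold H (Var n) c k s'"
    using unf_free.hyps(1) unfold.unf_free[OF _ _ unf_free.hyps(3,4), of k n c] by simp
  \<comment> \<open>What a free variable unfolds to is closed, so the substitution leaves it
    alone.\<close>
  then show ?case
    using subst_bound[OF unfold_bound[OF unf_free.hyps(4)]] by simp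
qed (auto intro: unfold.intros)

section \<open>The heap machine, its step count and divergence\<close>

type_synonym hstate = "clos list \<times> clos list \<times> heap"

text \<open>A call keeps the caller's rest \<open>P\<close> on the task stack even when
  \<open>P\<close> is empty. Dropping it would make the number of \<open>hs_Pop\<close> steps depend
  on the shape of the term and not only on the number of calls. Address 0 is the empty environment,
  as every lookup from it fails.\<close>

inductive hs :: "hstate \<Rightarrow> hstate \<Rightarrow> bool" where
  hs_Pop: "hs (([], a) # T, V, H) (T, V, H)"
| hs_Lam: "hs ((LamC # gamma u @ Ret # P, a) # T, V, H) ((P, a) # T, (gamma u, a) # V, H)"
| hs_Var: "lookup H a n = Some g \<Longrightarrow> hs ((VarC n # P, a) # T, V, H) ((P, a) # T, g # V, H)"
| hs_App: "hs ((AppC # P, a) # T, g # (Q, b) # V, H)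
    ((Q, Suc (length H)) # (P, a) # T, V, H @ [(g, b)])"

lemma prog_rep_is_lam: "prog_rep P u \<Longrightarrow> unfold H u b k s' \<Longrightarrow> \<exists>v. s' = Lam v"
  by (auto simp: prog_rep_def elim: unfold.cases)

inductive_cases unfold_VarE: "unfold H (Var n) a k s'"
inductive_cases unfold_AppE: "unfold H (App s t) a k s'"
inductive_cases unfold_LamE: "unfold H (Lam s) a k s'"

text \<open>Applications unfold to applications, so a term that unfolds to an abstraction is a
  variable or an abstraction. Either one takes a single push.\<close>

lemma hs_value:
  assumes "unfold H s a 0 (Lam v)"
  shows "\<exists>g. hs ((gamma s @ P, a) # T, V, H) ((P, a) # T, g # V, H) \<and> clos_rep H g (Lam v)"
  using assms
proof (cases s)
  case (Var n)
  from assms[unfolded Var] show ?thesis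
    by (rule unfold_VarE) (use Var in \<open>fastforce simp: clos_rep_def intro: hs_Var\<close>)+
next
  case (App t u)
  with assms show ?thesis by (auto elim: unfold_AppE)
next
  case (Lam u)
  then show ?thesis
    using assms hs_Lam[of u P a T V H] by (fastforce simp: clos_rep_def prog_rep_def)
qed

lemma clos_rep_Lam:
  assumes "clos_rep H (Q, b) (Lam v)"
  obtains q where "Q = gamma q" "unfold H q b 1 v"
  using assms by (auto simp: clos_rep_def prog_rep_def elim: unfold_LamE)

lemma unfold_beta:
  assumes "unfold H q b 1 v" "clos_rep H g w"
  shows "unfold (H @ [(g, b)]) q (Suc (length H)) 0 (subst v 0 w)"
  using assms by (intro unfold_subst[where b = b and g = g])
    (auto intro: unfold_append clos_rep_append)

lemma hs_trans: "(hs ^^ n) x y \<Longrightarrow> (hs ^^ m) y z \<Longrightarrow> (hs ^^ (n + m)) x z"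
  unfolding relpowp_add by (rule relcomppI)

lemma hs_Suc: "hs x y \<Longrightarrow> (hs ^^ m) y z \<Longrightarrow> (hs ^^ (1 + m)) x z"
  using hs_trans[of 1 x y m z] unfolding relpowp_1 .

text \<open>A value costs one push. An application adds one application step and one pop to the
  costs of its three premises: \<open>(4i+1) + (4j+1) + (4m+1) + 2 = 4(i+j+m+1) + 1\<close>.\<close>

lemma hs_eval:
  assumes "eval s' j t" "unfold H s a 0 s'"
  shows "\<exists>g H'. (hs ^^ (4 * j + 1)) ((gamma s @ P, a) # T, V, H) ((P, a) # T, g # V, H @ H') \<and>
    clos_rep (H @ H') g t"
  using assms
proof (induction arbitrary: H s a P T V rule: eval.induct)
  case (eval_Lam v)
  then show ?case
    using hs_value[OF eval_Lam, of P T V] by (metis append_Nil2 mult_0_right add_0 relpowp_1)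
next
  case (eval_App s1' i u s2' j v m w)
  obtain s1 s2 where s: "s = App s1 s2" "unfold H s1 a 0 s1'" "unfold H s2 a 0 s2'"
    using eval_App.prems prog_rep_is_lam by (cases rule: unfold.cases) fastforce+
  obtain g1 H1 where 1: "(hs ^^ (4 * i + 1)) ((gamma s1 @ gamma s2 @ AppC # P, a) # T, V, H)
      ((gamma s2 @ AppC # P, a) # T, g1 # V, H @ H1)" "clos_rep (H @ H1) g1 (Lam u)"
    using eval_App.IH(1)[OF s(2)] by blast
  obtain g2 H2 where 2: "(hs ^^ (4 * j + 1)) ((gamma s2 @ AppC # P, a) # T, g1 # V, H @ H1)
      ((AppC # P, a) # T, g2 # g1 # V, H @ H1 @ H2)" "clos_rep (H @ H1 @ H2) g2 (Lam v)"
    using eval_App.IH(2)[OF unfold_append[OF s(3)]] by (metis append.assoc)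
  obtain Q b where g1: "g1 = (Q, b)"
    by fastforce
  obtain q where q: "Q = gamma q" "unfold (H @ H1 @ H2) q b 1 u"
    using clos_rep_Lam[OF clos_rep_append[OF 1(2)[unfolded g1]]] by (metis append.assoc)
  define H3 where "H3 = H1 @ H2 @ [(g2, b)]"
  define c where "c = Suc (length (H @ H1 @ H2))"
  have 3: "hs ((AppC # P, a) # T, g2 # g1 # V, H @ H1 @ H2)
      ((gamma q @ [], c) # (P, a) # T, V, H @ H3)"
    using hs_App[of P a T g2 Q b V "H @ H1 @ H2"] by (simp add: g1 q(1) c_def H3_def)
  have "unfold (H @ H3) q c 0 (subst u 0 (Lam v))"
    using unfold_beta[OF q(2) 2(2)] by (simp add: c_def H3_def)
  from eval_App.IH(3)[OF this] obtain g4 H4 where 4: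
    "(hs ^^ (4 * m + 1)) ((gamma q @ [], c) # (P, a) # T, V, H @ H3)
      (([], c) # (P, a) # T, g4 # V, H @ H3 @ H4)" "clos_rep (H @ H3 @ H4) g4 w"
    by (metis append.assoc)
  have 5: "(hs ^^ 1) (([], c) # (P, a) # T, g4 # V, H @ H3 @ H4) ((P, a) # T, g4 # V, H @ H3 @ H4)"
    unfolding relpowp_1 by (rule hs_Pop)
  have "(hs ^^ ((4 * i + 1) + ((4 * j + 1) + (1 + ((4 * m + 1) + 1)))))
      ((gamma s1 @ gamma s2 @ AppC # P, a) # T, V, H) ((P, a) # T, g4 # V, H @ H3 @ H4)"
    using hs_trans[OF 1(1) hs_trans[OF 2(1) hs_Suc[OF 3 hs_trans[OF 4(1) 5]]]] .
  moreover have "(4 * i + 1) + ((4 * j + 1) + (1 + ((4 * m + 1) + 1))) = 4 * Suc (i + j + m) + 1"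
    by simp
  ultimately show ?case
    using 4(2) s(1) by (metis append.assoc append_Cons append_Nil gamma.simps(2))
qed

text \<open>Nested induction, outside on the required length and inside on the term. A term without
  a value unfolds to an application. If its operator or operand has no value, the inner hypothesis
  applies to a smaller term. Otherwise the instantiated body has none; it may be larger, but steps
  have been made to reach it, so the outer hypothesis suffices.\<close>

lemma hs_diverge:
  assumes "unfold H s a 0 s'" "\<not> (\<exists>j t. eval s' j t)"
  shows "\<exists>n \<ge> m. \<exists>\<sigma>. (hs ^^ n) ((gamma s @ P, a) # T, V, H) \<sigma> \<and> fst \<sigma> \<noteq> []"
  using assms
proof (induction m arbitrary: s s' a P T V H)
  case 0
  then show ?case by (intro exI[of _ 0]) auto
next
  case (Suc m)
  note IHm = Suc.IH
  show ?case
    using Suc.prems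
  proof (induction s arbitrary: s' a P T V H)
    case (Var n)
    then have "\<exists>v. s' = Lam v"
      using prog_rep_is_lam by (auto elim: unfold_VarE)
    then show ?case
      using Var.prems(2) eval_Lam by blast
  next
    case (Lam s)
    from Lam.prems(1) obtain v where "s' = Lam v"
      by (auto elim: unfold_LamE)
    then show ?case
      using Lam.prems(2) eval_Lam by blast
  next
    case (App s1 s2)
    obtain s1' s2' where s: "s' = App s1' s2'" "unfold H s1 a 0 s1'" "unfold H s2 a 0 s2'"
      using App.prems(1) by (auto elim: unfold_AppE)
    show ?case
    proof (cases "\<exists>j t. eval s1' j t")
      case False
      then show ?thesis
        using App.IH(1)[OF s(2)] by simp
    next
      case True
      then obtain i u where ev1: "eval s1' i (Lam u)"
        using eval_is_lam by blast
      obtain g1 H1 where 1: "(hs ^^ (4 * i + 1)) ((gamma s1 @ gamma s2 @ AppC # P, a) # T, V, H)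
          ((gamma s2 @ AppC # P, a) # T, g1 # V, H @ H1)" "clos_rep (H @ H1) g1 (Lam u)"
        using hs_eval[OF ev1 s(2)] by blast
      note s2 = unfold_append[OF s(3), of H1]
      show ?thesis
      proof (cases "\<exists>j t. eval s2' j t")
        case False
        obtain n \<sigma> where "n \<ge> Suc m"
          "(hs ^^ n) ((gamma s2 @ AppC # P, a) # T, g1 # V, H @ H1) \<sigma>" "fst \<sigma> \<noteq> []"
          using App.IH(2)[OF s2 False] by blast
        then show ?thesis
          using hs_trans[OF 1(1), of n \<sigma>]
          by (metis append.assoc append_Cons append_Nil gamma.simps(2) trans_le_add2)
      next
        case True
        then obtain j v where ev2: "eval s2' j (Lam v)"
          using eval_is_lam by blast
        obtain g2 H2 where 2: "(hs ^^ (4 * j + 1)) ((gamma s2 @ AppC # P, a) # T, g1 # V, H @ H1)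
            ((AppC # P, a) # T, g2 # g1 # V, H @ H1 @ H2)" "clos_rep (H @ H1 @ H2) g2 (Lam v)"
          using hs_eval[OF ev2 s2] by (metis append.assoc)
        obtain Q b where g1: "g1 = (Q, b)"
          by fastforce
        obtain q where q: "Q = gamma q" "unfold (H @ H1 @ H2) q b 1 u"
          using clos_rep_Lam[OF clos_rep_append[OF 1(2)[unfolded g1]]] by (metis append.assoc)
        define H3 where "H3 = (H @ H1 @ H2) @ [(g2, b)]"
        define c where "c = Suc (length (H @ H1 @ H2))"
        have 3: "hs ((AppC # P, a) # T, g2 # g1 # V, H @ H1 @ H2)
            ((gamma q @ [], c) # (P, a) # T, V, H3)"
          using hs_App[of P a T g2 Q b V "H @ H1 @ H2"] by (simp add: g1 q(1) c_def H3_def)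
        have 4: "unfold H3 q c 0 (subst u 0 (Lam v))"
          using unfold_beta[OF q(2) 2(2)] by (simp add: c_def H3_def)
        have "\<not> (\<exists>j t. eval (subst u 0 (Lam v)) j t)"
          using eval_App[OF ev1 ev2] App.prems(2) s(1) by blast
        from IHm[OF 4 this] obtain n \<sigma> where n: "n \<ge> m"
          "(hs ^^ n) ((gamma q @ [], c) # (P, a) # T, V, H3) \<sigma>" "fst \<sigma> \<noteq> []"
          by blast
        have "(hs ^^ ((4 * i + 1) + ((4 * j + 1) + (1 + n))))
            ((gamma s1 @ gamma s2 @ AppC # P, a) # T, V, H) \<sigma>"
          using hs_trans[OF 1(1) hs_trans[OF 2(1) hs_Suc[OF 3 n(2)]]] .
        moreover have "Suc m \<le> (4 * i + 1) + ((4 * j + 1) + (1 + n))"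
          using n(1) by simp
        ultimately show ?thesis
          using n(3) s(1) by (metis append.assoc append_Cons append_Nil gamma.simps(2))
      qed
    qed
  qed
qed

lemma hs_tasks_nonempty: "hs \<sigma> \<sigma>' \<Longrightarrow> fst \<sigma> \<noteq> []"
  by (auto elim: hs.cases)

text \<open>No step leaves a state without tasks, so every state with a successor still has
  tasks.\<close>

lemma hs_prefix:
  assumes "(hs ^^ n) \<sigma> \<sigma>'" "m \<le> n" "m < n \<or> fst \<sigma>' \<noteq> []"
  shows "\<exists>\<sigma>''. (hs ^^ m) \<sigma> \<sigma>'' \<and> fst \<sigma>'' \<noteq> []"
proof (cases "m = n")
  case False
  then obtain i where "n = m + Suc i"
    using assms(2) by (metis add_Suc_right le_neq_implies_less less_natE)
  then obtain \<sigma>'' where 1: "(hs ^^ m) \<sigma> \<sigma>''" "(hs ^^ Suc i) \<sigma>'' \<sigma>'"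
    using assms(1) by (metis relpowp_add relcomppE)
  then show ?thesis
    using hs_tasks_nonempty relpowp_Suc_D2 by metis
qed (use assms in blast)

theorem hs_terminates:
  assumes "closed s" "eval s j t"
  shows "\<exists>g H. (hs ^^ (4 * j + 2)) ([(gamma s, 0)], [], []) ([], [g], H) \<and> clos_rep H g t"
proof -
  obtain g H where 1: "(hs ^^ (4 * j + 1)) ([(gamma s, 0)], [], []) ([([], 0)], [g], H)"
    "clos_rep H g t"
    using hs_eval[OF assms(2) bound_unfold, of "[]" 0 "[]" "[]" "[]"] assms(1)
    by (auto simp: closed_def)
  have "(hs ^^ ((4 * j + 1) + 1)) ([(gamma s, 0)], [], []) ([], [g], H)"
    using hs_trans[OF 1(1), of 1] hs_Pop unfolding relpowp_1 by blast
  moreover have "(4 * j + 1) + 1 = 4 * j + 2"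
    by simp
  ultimately show ?thesis using 1(2) by metis
qed

text \<open>Termination after more than \<open>k\<close> steps and divergence look alike to a
  machine that stops after \<open>k\<close> steps, so both kinds of failure are merged here.\<close>

theorem hs_runs_long:
  assumes "closed s" "\<not> (\<exists>nf. normal_form s nf \<and> 4 * Time s + 2 \<le> k)"
  shows "\<exists>\<sigma>. (hs ^^ k) ([(gamma s, 0)], [], []) \<sigma> \<and> fst \<sigma> \<noteq> []"
proof (cases "\<exists>j t. eval s j t")
  case True
  then obtain j t where ev: "eval s j t"
    by blast
  then have "k < 4 * j + 2"
    using assms(2) by (auto simp: normal_form_def reduces_in_iff_eval Time_eval[OF ev])
  then show ?thesis
    using hs_terminates[OF assms(1) ev] hs_prefix by (metis less_imp_le)
next
  case False
  have "unfold [] s 0 0 s"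
    using assms(1) by (simp add: bound_unfold closed_def)
  from hs_diverge[OF this False, of k "[]" "[]" "[]"] show ?thesis
    using hs_prefix by (metis append_Nil2)
qed

section \<open>Weakest preconditions with running time\<close>

text \<open>The time \<open>t\<close> is the number of steps made before \<open>c\<close> starts, so that costs accumulate in the
  postcondition when programs are composed.\<close>

definition wp :: "'r com \<Rightarrow> ('r \<Rightarrow> sym list) \<Rightarrow> nat \<Rightarrow> (('r \<Rightarrow> sym list) \<Rightarrow> nat \<Rightarrow> bool) \<Rightarrow> bool" where
  "wp c s t Q \<longleftrightarrow> (\<exists>n s'. bs c s n s' \<and> Q s' (t + n))"

inductive_cases bs_SkipE: "bs Skip s n s'"
inductive_cases bs_PushE: "bs (Push r a) s n s'"
inductive_cases bs_PopE: "bs (Pop r) s n s'"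
inductive_cases bs_SeqE: "bs (Seq c d) s n s'"
inductive_cases bs_CaseE: "bs (Case r f) s n s'"
inductive_cases bs_WhileE: "bs (While r p c) s n s'"

lemma wp_Skip [simp]: "wp Skip s t Q = Q s (t + 1)"
proof -
  have "bs Skip s n s' \<longleftrightarrow> n = 1 \<and> s' = s" for n s'
    by (metis bs_Skip bs_SkipE)
  then show ?thesis by (simp add: wp_def)
qed

lemma wp_Push [simp]: "wp (Push r a) s t Q = Q (s(r := a # s r)) (t + 2)"
proof -
  have "bs (Push r a) s n s' \<longleftrightarrow> n = 2 \<and> s' = s(r := a # s r)" for n s'
    by (metis bs_Push bs_PushE)
  then show ?thesis by (simp add: wp_def)
qed

lemma wp_Pop [simp]: "wp (Pop r) s t Q = Q (s(r := tl (s r))) (t + 1)"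
proof -
  have "bs (Pop r) s n s' \<longleftrightarrow> n = 1 \<and> s' = s(r := tl (s r))" for n s'
    by (metis bs_Pop bs_PopE)
  then show ?thesis by (simp add: wp_def)
qed

lemma wp_Seq [simp]: "wp (Seq c d) s t Q = wp c s (t + 1) (\<lambda>s' t'. wp d s' t' Q)"
proof
  assume "wp (Seq c d) s t Q"
  then show "wp c s (t + 1) (\<lambda>s' t'. wp d s' t' Q)"
    unfolding wp_def by (force elim: bs_SeqE simp: add_ac)
next
  assume "wp c s (t + 1) (\<lambda>s' t'. wp d s' t' Q)"
  then obtain n s' m s'' where "bs c s n s'" "bs d s' m s''" "Q s'' (t + 1 + n + m)"
    by (auto simp: wp_def)
  then show "wp (Seq c d) s t Q"
    unfolding wp_def
    using bs_Seq[of c s n s' d m s'']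
    by (intro exI[of _ "Suc (n + m)"] exI[of _ s'']) (simp_all add: add_ac)
qed

lemma wp_Case [simp]: "wp (Case r f) s t Q = wp (f (top_of (s r))) s (t + 1) Q"
proof
  assume "wp (Case r f) s t Q"
  then show "wp (f (top_of (s r))) s (t + 1) Q"
    unfolding wp_def by (force elim: bs_CaseE)
next
  assume "wp (f (top_of (s r))) s (t + 1) Q"
  then obtain n s' where "bs (f (top_of (s r))) s n s'" "Q s' (t + 1 + n)"
    by (auto simp: wp_def)
  then show "wp (Case r f) s t Q"
    unfolding wp_def by (intro exI[of _ "Suc n"] exI[of _ s']) (auto intro: bs_Case)
qed

lemma wp_While: "wp (While r p c) s t Q =
  (if p (top_of (s r)) then wp c s (t + 1) (\<lambda>s' t'. wp (While r p c) s' t' Q) else Q s (t + 1))"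
proof
  assume "wp (While r p c) s t Q"
  then obtain n s' where b: "bs (While r p c) s n s'" "Q s' (t + n)"
    by (auto simp: wp_def)
  from b(1) show "if p (top_of (s r)) then wp c s (t + 1) (\<lambda>s' t'. wp (While r p c) s' t' Q)
      else Q s (t + 1)"
    by (rule bs_WhileE) (use b(2) in \<open>force simp: wp_def add_ac\<close>)+
next
  assume a: "if p (top_of (s r)) then wp c s (t + 1) (\<lambda>s' t'. wp (While r p c) s' t' Q)
      else Q s (t + 1)"
  show "wp (While r p c) s t Q"
  proof (cases "p (top_of (s r))")
    case True
    with a obtain n s' m s'' where "bs c s n s'" "bs (While r p c) s' m s''" "Q s'' (t + 1 + n + m)"
      by (auto simp: wp_def)
    then show ?thesis
      unfolding wp_def using bs_WhileT[of p s r c n s' m s''] True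
      by (intro exI[of _ "Suc (n + m)"] exI[of _ s'']) (auto simp: add_ac)
  next
    case False
    then show ?thesis
      using a bs_WhileF[of p s r c] unfolding wp_def
      by (intro exI[of _ 1] exI[of _ s]) simp
  qed
qed

fun lift_pred :: "('a \<Rightarrow> bool) \<Rightarrow> 'a option \<Rightarrow> bool" where
  "lift_pred P None = False"
| "lift_pred P (Some x) = P x"

definition mv1 :: "'r \<Rightarrow> 'r \<Rightarrow> 'r com" where
  "mv1 i j = Case i (\<lambda>o'. Seq (Pop i) (Push j (the o')))"

definition mv :: "'r \<Rightarrow> 'r \<Rightarrow> (sym \<Rightarrow> bool) \<Rightarrow> 'r com" where
  "mv i j P = While i (lift_pred P) (mv1 i j)"

definition mv2 :: "'r \<Rightarrow> 'r \<Rightarrow> 'r \<Rightarrow> (sym \<Rightarrow> bool) \<Rightarrow> 'r com" where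
  "mv2 i j k P = While i (lift_pred P)
     (Case i (\<lambda>o'. Seq (Pop i) (Seq (Push j (the o')) (Push k (the o')))))"

definition drop_sym :: "'r \<Rightarrow> (sym \<Rightarrow> bool) \<Rightarrow> 'r com" where
  "drop_sym i P = While i (lift_pred P) (Pop i)"

lemma wp_mv1 [simp]:
  "i \<noteq> j \<Longrightarrow> wp (mv1 i j) s t Q = Q (s(i := tl (s i), j := the (top_of (s i)) # s j)) (t + 5)"
  by (simp add: mv1_def numeral_eq_Suc)

text \<open>Each symbol costs one loop test and the five steps of \<open>mv1\<close>; the last 1 is
  the failing test. Being an equation with exact cost, the rule lets the simplifier execute
  straight-line programs symbolically.\<close>

lemma wp_mv [simp]:
  assumes "i \<noteq> j"
  shows "wp (mv i j P) s t Q =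
    Q (s(i := dropWhile P (s i), j := rev (takeWhile P (s i)) @ s j))
      (t + (6 * length (takeWhile P (s i)) + 1))"
proof (induction "s i" arbitrary: s t)
  case Nil
  then show ?case
    by (simp add: mv_def wp_While fun_upd_idem flip: Nil)
next
  case (Cons x xs)
  have si: "s i = x # xs"
    using Cons.hyps(2) by simp
  show ?case
  proof (cases "P x")
    case True
    let ?s = "s(i := xs, j := x # s j)"
    have "wp (mv i j P) s t Q = wp (mv i j P) ?s (t + 6) Q"
      using assms si True unfolding mv_def by (subst wp_While) (simp add: add_ac)
    also have "\<dots> = Q (?s(i := dropWhile P xs, j := rev (takeWhile P xs) @ x # s j))
        (t + 6 + (6 * length (takeWhile P xs) + 1))"
      using Cons.hyps(1)[of ?s "t + 6"] assms by simp
    also note eq = calculation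
    have upd: "?s(i := dropWhile P xs, j := rev (takeWhile P xs) @ x # s j) =
        s(i := dropWhile P xs, j := rev (takeWhile P xs) @ x # s j)"
      using assms by (auto simp: fun_eq_iff)
    show ?thesis
      using si True unfolding eq upd by (simp add: add_ac)
  next
    case False
    then show ?thesis
      using si by (simp add: mv_def wp_While fun_upd_idem)
  qed
qed

lemma wp_mv2 [simp]:
  assumes "i \<noteq> j" "i \<noteq> k" "j \<noteq> k"
  shows "wp (mv2 i j k P) s t Q =
    Q (s(i := dropWhile P (s i), j := rev (takeWhile P (s i)) @ s j, k := rev (takeWhile P (s i)) @ s k))
      (t + (9 * length (takeWhile P (s i)) + 1))"
proof (induction "s i" arbitrary: s t)
  case Nil
  then show ?case
    by (simp add: mv2_def wp_While fun_upd_idem flip: Nil)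
next
  case (Cons x xs)
  have si: "s i = x # xs"
    using Cons.hyps(2) by simp
  show ?case
  proof (cases "P x")
    case True
    let ?s = "s(i := xs, j := x # s j, k := x # s k)"
    let ?r = "rev (takeWhile P xs)"
    have "wp (mv2 i j k P) s t Q = wp (mv2 i j k P) ?s (t + 9) Q"
      using assms si True unfolding mv2_def by (subst wp_While) (simp add: numeral_eq_Suc)
    also have "\<dots> = Q (?s(i := dropWhile P xs, j := ?r @ x # s j, k := ?r @ x # s k))
        (t + 9 + (9 * length (takeWhile P xs) + 1))"
      using Cons.hyps(1)[of ?s "t + 9"] assms by simp
    also note eq = calculation
    have upd: "?s(i := dropWhile P xs, j := ?r @ x # s j, k := ?r @ x # s k) =
        s(i := dropWhile P xs, j := ?r @ x # s j, k := ?r @ x # s k)"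
      using assms by (auto simp: fun_eq_iff)
    show ?thesis
      using si True unfolding eq upd by (simp add: add_ac)
  next
    case False
    then show ?thesis
      using si by (simp add: mv2_def wp_While fun_upd_idem)
  qed
qed

lemma wp_drop_sym [simp]:
  "wp (drop_sym i P) s t Q =
    Q (s(i := dropWhile P (s i))) (t + (2 * length (takeWhile P (s i)) + 1))"
proof (induction "s i" arbitrary: s t)
  case Nil
  then show ?case
    by (simp add: drop_sym_def wp_While fun_upd_idem flip: Nil)
next
  case (Cons x xs)
  have si: "s i = x # xs"
    using Cons.hyps(2) by simp
  show ?case
  proof (cases "P x")
    case True
    have "wp (drop_sym i P) s t Q = wp (drop_sym i P) (s(i := xs)) (t + 2) Q"
      using si True unfolding drop_sym_def by (subst wp_While) (simp add: numeral_eq_Suc)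
    also have "\<dots> = Q (s(i := dropWhile P xs)) (t + 2 + (2 * length (takeWhile P xs) + 1))"
      using Cons.hyps(1)[of "s(i := xs)" "t + 2"] by simp
    finally show ?thesis
      using si True by (simp add: add_ac)
  next
    case False
    then show ?thesis
      using si by (simp add: drop_sym_def wp_While fun_upd_idem)
  qed
qed

section \<open>Encoded numbers and programs, binary counters\<close>

definition is_bit :: "sym \<Rightarrow> bool" where
  "is_bit x \<longleftrightarrow> x = S0 \<or> x = S1"

definition is_cmd :: "sym \<Rightarrow> bool" where
  "is_cmd x \<longleftrightarrow> x \<in> {SRet, SVar, SLam, SApp, STick}"

declare enc_num.simps [simp del]

lemma enc_num_0 [simp]: "enc_num 0 = []"
  by (simp add: enc_num.simps)

lemma is_bit_enc_num: "x \<in> set (enc_num n) \<Longrightarrow> is_bit x"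
proof (induction n rule: enc_num.induct)
  case (1 n)
  then show ?case
    by (subst (asm) (2) enc_num.simps) (auto simp: is_bit_def split: if_splits)
qed

lemma is_cmd_enc_prog: "x \<in> set (enc_prog P) \<Longrightarrow> is_cmd x"
proof -
  have "x \<in> set (enc_cmd c) \<Longrightarrow> is_cmd x" for c
    by (cases c) (auto simp: is_cmd_def)
  then show "x \<in> set (enc_prog P) \<Longrightarrow> is_cmd x"
    by (auto simp: enc_prog_def)
qed

lemma enc_prog_simps [simp]:
  "enc_prog [] = []"
  "enc_prog (c # P) = enc_cmd c @ enc_prog P"
  "enc_prog (P @ P') = enc_prog P @ enc_prog P'"
  by (simp_all add: enc_prog_def)

lemma takeWhile_all_append:
  "\<forall>x \<in> set xs. P x \<Longrightarrow> takeWhile P (xs @ ys) = xs @ takeWhile P ys"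
  "\<forall>x \<in> set xs. P x \<Longrightarrow> dropWhile P (xs @ ys) = dropWhile P ys"
  by (simp_all add: takeWhile_append2 dropWhile_append2)

lemma takeWhile_enc_num [simp]:
  "takeWhile is_bit (enc_num n @ ys) = enc_num n @ takeWhile is_bit ys"
  "dropWhile is_bit (enc_num n @ ys) = dropWhile is_bit ys"
  "takeWhile is_bit (rev (enc_num n) @ ys) = rev (enc_num n) @ takeWhile is_bit ys"
  "dropWhile is_bit (rev (enc_num n) @ ys) = dropWhile is_bit ys"
  "takeWhile is_bit (enc_num n) = enc_num n"
  "dropWhile is_bit (enc_num n) = []"
  "takeWhile is_bit (rev (enc_num n)) = rev (enc_num n)"
  "dropWhile is_bit (rev (enc_num n)) = []"
  using is_bit_enc_num[of _ n] by (auto simp: takeWhile_all_append takeWhile_eq_all_conv dropWhile_eq_Nil_conv)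

lemma takeWhile_enc_prog [simp]:
  "takeWhile is_cmd (enc_prog P @ ys) = enc_prog P @ takeWhile is_cmd ys"
  "dropWhile is_cmd (enc_prog P @ ys) = dropWhile is_cmd ys"
  "takeWhile is_cmd (rev (enc_prog P) @ ys) = rev (enc_prog P) @ takeWhile is_cmd ys"
  "dropWhile is_cmd (rev (enc_prog P) @ ys) = dropWhile is_cmd ys"
  "takeWhile is_cmd (enc_prog P) = enc_prog P"
  "dropWhile is_cmd (enc_prog P) = []"
  "takeWhile is_cmd (rev (enc_prog P)) = rev (enc_prog P)"
  "dropWhile is_cmd (rev (enc_prog P)) = []"
  using is_cmd_enc_prog[of _ P] by (auto simp: takeWhile_all_append takeWhile_eq_all_conv dropWhile_eq_Nil_conv)

lemma is_bit_simps [simp]: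
  "is_bit S0" "is_bit S1" "\<not> is_bit SSep" "\<not> is_bit SComma" "\<not> is_bit SRpar" "\<not> is_bit SLpar"
  by (simp_all add: is_bit_def)

lemma is_cmd_simps [simp]:
  "is_cmd SRet" "is_cmd SVar" "is_cmd SLam" "is_cmd SApp" "is_cmd STick"
  "\<not> is_cmd SSep" "\<not> is_cmd SComma" "\<not> is_cmd SRpar" "\<not> is_cmd SLpar"
  by (simp_all add: is_cmd_def)

fun binval :: "sym list \<Rightarrow> nat" where
  "binval [] = 0"
| "binval (x # xs) = (if x = S1 then 1 else 0) + 2 * binval xs"

lemma binval_enc_num [simp]: "binval (enc_num n) = n"
proof (induction n rule: enc_num.induct)
  case (1 n)
  show ?case
  proof (cases "n = 0")
    case False
    then have "binval (enc_num n) = (if n mod 2 = 0 then 0 else 1) + 2 * (n div 2)"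
      using 1 by (subst enc_num.simps) auto
    then show ?thesis by presburger
  qed simp
qed

lemma length_enc_num: "length (enc_num n) \<le> n"
proof (induction n rule: enc_num.induct)
  case (1 n)
  show ?case
  proof (cases "n = 0")
    case False
    then have "length (enc_num n) = Suc (length (enc_num (n div 2)))"
      by (subst enc_num.simps) auto
    also have "\<dots> \<le> Suc (n div 2)"
      using 1 False by simp
    also have "\<dots> \<le> n"
      using False by simp
    finally show ?thesis .
  qed simp
qed

fun inc :: "sym list \<Rightarrow> sym list" where
  "inc [] = [S1]"
| "inc (x # xs) = (if x = S1 then S0 # inc xs else S1 # xs)"

lemma enc_num_Suc: "enc_num (Suc n) = inc (enc_num n)"
proof (induction n rule: enc_num.induct)
  case (1 n)
  show ?case
  proof (cases "n = 0")
    case False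
    then show ?thesis
      using 1 by (cases "n mod 2 = 0"; subst enc_num.simps; subst (2) enc_num.simps)
        (auto simp: mod_Suc div_Suc)
  qed (simp add: enc_num.simps)
qed

text \<open>Decrement keeps the length, so that the result may have leading zeros.\<close>

fun dec :: "sym list \<Rightarrow> sym list" where
  "dec [] = []"
| "dec (x # xs) = (if x = S1 then S0 # xs else S1 # dec xs)"

lemma length_dec [simp]: "length (dec xs) = length xs"
  by (induction xs) auto

lemma binval_dec: "binval xs \<noteq> 0 \<Longrightarrow> binval (dec xs) = binval xs - 1"
  by (induction xs) (auto split: if_splits)

lemma is_bit_dec: "\<forall>x \<in> set xs. is_bit x \<Longrightarrow> \<forall>x \<in> set (dec xs). is_bit x"
  by (induction xs) auto

definition incr :: "'r \<Rightarrow> 'r \<Rightarrow> 'r com" where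
  "incr aux i = Seq (While i (lift_pred (\<lambda>x. x = S1)) (Seq (Pop i) (Push aux S0)))
     (Seq (Pop i) (Seq (Push i S1) (mv aux i (\<lambda>_. True))))"

text \<open>On zero, the number is erased and \<open>STick\<close> is pushed on \<open>fl\<close>.\<close>

definition decr :: "'r \<Rightarrow> 'r \<Rightarrow> 'r \<Rightarrow> 'r com" where
  "decr aux fl i = Seq (While i (lift_pred (\<lambda>x. x = S0)) (Seq (Pop i) (Push aux S1)))
     (Case i (\<lambda>x. if x = None then Seq (drop_sym aux (\<lambda>_. True)) (Push fl STick)
        else Seq (Pop i) (Seq (Push i S0) (mv aux i (\<lambda>_. True)))))"

lemma takeWhile_True [simp]: "takeWhile (\<lambda>_. True) xs = xs" "dropWhile (\<lambda>_. True) xs = []"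
  by (induction xs) auto

lemma wp_replace_while:
  assumes "i \<noteq> j"
  shows "wp (While i (lift_pred P) (Seq (Pop i) (Push j a))) s t Q =
    Q (s(i := dropWhile P (s i), j := replicate (length (takeWhile P (s i))) a @ s j))
      (t + (5 * length (takeWhile P (s i)) + 1))"
proof (induction "s i" arbitrary: s t)
  case Nil
  then show ?case
    by (simp add: wp_While fun_upd_idem flip: Nil)
next
  case (Cons x xs)
  have si: "s i = x # xs"
    using Cons.hyps(2) by simp
  let ?w = "While i (lift_pred P) (Seq (Pop i) (Push j a))"
  show ?case
  proof (cases "P x")
    case True
    let ?s = "s(i := xs, j := a # s j)"
    let ?r = "replicate (length (takeWhile P xs)) a"
    have "wp ?w s t Q = wp ?w ?s (t + 5) Q"
      using assms si True by (subst wp_While) (simp add: numeral_eq_Suc)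
    also have "\<dots> = Q (?s(i := dropWhile P xs, j := ?r @ a # s j))
        (t + 5 + (5 * length (takeWhile P xs) + 1))"
      using Cons.hyps(1)[of ?s "t + 5"] assms by simp
    also note eq = calculation
    have upd: "?s(i := dropWhile P xs, j := ?r @ a # s j) =
        s(i := dropWhile P xs, j := ?r @ a # s j)"
      using assms by (auto simp: fun_eq_iff)
    show ?thesis
      using si True unfolding eq upd by (simp add: add_ac replicate_app_Cons_same)
  next
    case False
    then show ?thesis
      using si by (simp add: wp_While fun_upd_idem)
  qed
qed

text \<open>\<open>tl [] = []\<close> lets the formula cover a carry out of an all-ones number; in
  \<open>incr\<close> this is a pop from an empty stack.\<close>

lemma inc_eq: "inc xs = replicate (length (takeWhile (\<lambda>x. x = S1) xs)) S0 @
    S1 # tl (dropWhile (\<lambda>x. x = S1) xs)"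
  by (induction xs) auto

lemma dec_eq:
  "\<forall>x \<in> set xs. is_bit x \<Longrightarrow> binval xs \<noteq> 0 \<Longrightarrow>
    dec xs = replicate (length (takeWhile (\<lambda>x. x = S0) xs)) S1 @
      S0 # tl (dropWhile (\<lambda>x. x = S0) xs) \<and> dropWhile (\<lambda>x. x = S0) xs \<noteq> []"
  by (induction xs) (auto simp: is_bit_def split: if_splits)

lemma binval_0_dropWhile:
  "\<forall>x \<in> set xs. is_bit x \<Longrightarrow> binval xs = 0 \<Longrightarrow> dropWhile (\<lambda>x. x = S0) xs = []"
  by (induction xs) (auto simp: is_bit_def split: if_splits)

text \<open>The factor 11 consists of 5 steps per carried bit and 6 for moving it back from the
  auxiliary stack; 20 absorbs the constant part. The postcondition is required for all times up to
  the bound, which turns exact costs into estimates.\<close>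

lemma wp_incr:
  assumes "i \<noteq> j" "s j = []"
    and Q: "\<And>t'. t' \<le> t + 11 * length (s i) + 20 \<Longrightarrow> Q (s(i := inc (s i))) t'"
  shows "wp (incr j i) s t Q"
proof -
  have le: "length (takeWhile (\<lambda>x. x = S1) (s i)) \<le> length (s i)"
    by (rule length_takeWhile_le)
  show ?thesis
    using assms(1,2) le
    by (auto simp: incr_def wp_replace_while inc_eq fun_upd_idem fun_upd_twist[of i j]
        intro!: Q[unfolded inc_eq])
qed

lemma wp_decr:
  assumes "i \<noteq> j" "fl \<noteq> i" "fl \<noteq> j" "s j = []" "\<forall>x \<in> set (s i). is_bit x"
    and Q: "\<And>t'. t' \<le> t + 11 * length (s i) + 20 \<Longrightarrow> binval (s i) \<noteq> 0 \<Longrightarrow> Q (s(i := dec (s i))) t'"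
    and Q0: "\<And>t'. t' \<le> t + 11 * length (s i) + 20 \<Longrightarrow> binval (s i) = 0 \<Longrightarrow>
      Q (s(i := [], fl := STick # s fl)) t'"
  shows "wp (decr j fl i) s t Q"
proof (cases "binval (s i) = 0")
  case True
  have le: "length (takeWhile (\<lambda>x. x = S0) (s i)) \<le> length (s i)"
    by (rule length_takeWhile_le)
  then show ?thesis
    using assms(1-4) True binval_0_dropWhile[OF assms(5) True]
    by (auto simp: decr_def wp_replace_while fun_upd_idem fun_upd_twist[of _ j]
        simp del: dropWhile_eq_Nil_conv intro!: Q0)
next
  case False
  have le: "length (takeWhile (\<lambda>x. x = S0) (s i)) \<le> length (s i)"
    by (rule length_takeWhile_le)
  obtain y ys where y: "dropWhile (\<lambda>x. x = S0) (s i) = y # ys"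
    using dec_eq[OF assms(5) False] by (cases "dropWhile (\<lambda>x. x = S0) (s i)") auto
  then have d: "dec (s i) = replicate (length (takeWhile (\<lambda>x. x = S0) (s i))) S1 @ S0 # ys"
    using dec_eq[OF assms(5) False] by simp
  show ?thesis
    using assms(1-4) le y False
    by (auto simp: decr_def wp_replace_while fun_upd_idem fun_upd_twist[of i j]
        intro!: Q[unfolded d])
qed

section \<open>The heap machine as a stack program\<close>

text \<open>Tasks and values are each kept on two parallel stacks, one for programs and one for addresses,
  with \<open>SSep\<close> after each item.  Between machine steps the heap is on \<open>Hp\<close>, reversed, so that a new
  entry is appended by pushing; it is read through \<open>Out\<close>, tape 1.\<close>

datatype reg = Aux | Out | Cnt | Flag | TskP | TskA | ValP | ValA | Hp | Len | Adr | Idx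

abbreviation always :: "sym \<Rightarrow> bool" where
  "always \<equiv> \<lambda>_. True"

text \<open>Every move reverses, so a copy goes through \<open>Aux\<close>: the second move restores
  the original and fills the copy in the right order.\<close>

definition copy_num :: "reg \<Rightarrow> reg \<Rightarrow> reg com" where
  "copy_num i j = Seq (mv i Aux is_bit) (mv2 Aux i j always)"

definition pop_step :: "reg com" where
  "pop_step = Seq (Pop TskP) (Seq (drop_sym TskA is_bit) (Pop TskA))"

text \<open>The height of \<open>Flag\<close> is the nesting depth of the abstraction whose body is being moved.\<close>

definition lam_loop :: "reg com" where
  "lam_loop = While Flag (lift_pred always) (Case TskP (\<lambda>x.
     if x = Some SLam then Seq (Push Flag STick) (mv1 TskP Aux)
     else if x = Some SRet then
       Seq (Pop Flag) (Case Flag (\<lambda>y. if y = None then Pop TskP else mv1 TskP Aux))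
     else mv1 TskP Aux))"

definition lam_step :: "reg com" where
  "lam_step = Seq (Pop TskP) (Seq (Push Flag STick) (Seq lam_loop
     (Seq (Push ValP SSep) (Seq (mv Aux ValP always)
     (Seq (Push ValA SSep) (copy_num TskA ValA))))))"

text \<open>An encoded entry contains exactly two closing parentheses, that of the closure and its
  own.\<close>

definition skip_entry :: "reg com" where
  "skip_entry = Seq (mv Out Hp (\<lambda>x. x \<noteq> SRpar)) (Seq (mv1 Out Hp)
     (Seq (mv Out Hp (\<lambda>x. x \<noteq> SRpar)) (mv1 Out Hp)))"

text \<open>Addresses are 1-based, so \<open>a\<close> successful decrements move \<open>a\<close>
  entries to \<open>Hp\<close>, the wanted one last. The decrement of zero raises
  \<open>Flag\<close> and thereby ends the loop.\<close>

definition seek_loop :: "reg com" where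
  "seek_loop = While Flag (\<lambda>x. x = None) (Seq (decr Aux Flag Adr)
     (Case Flag (\<lambda>x. if x = None then skip_entry else Skip)))"

definition seek :: "reg com" where
  "seek = Seq seek_loop (Pop Flag)"

text \<open>After \<open>seek\<close> the entry looked for is on top of \<open>Hp\<close> with its symbols reversed, so that moving
  its components pushes them in the right order.\<close>

definition get_tail :: "reg com" where
  "get_tail = Seq (mv1 Hp Out) (mv2 Hp Out Adr is_bit)"

text \<open>A reversed entry begins with its tail address. The first four moves pass over the
  closing parenthesis, that address, the comma and the parenthesis of the closure.\<close>

definition get_clos :: "reg com" where
  "get_clos = Seq (mv1 Hp Out) (Seq (mv Hp Out is_bit) (Seq (mv1 Hp Out) (Seq (mv1 Hp Out)
     (Seq (Push ValA SSep) (Seq (mv2 Hp Out ValA is_bit) (Seq (mv1 Hp Out)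
     (Seq (Push ValP SSep) (mv2 Hp Out ValP is_cmd))))))))"

text \<open>Each round replaces the address by the tail address found there and consumes one tick of
  the unary index. Between rounds the whole heap is on \<open>Out\<close>.\<close>

definition lookup_loop :: "reg com" where
  "lookup_loop = While Idx (lift_pred always)
     (Seq seek (Seq get_tail (Seq (mv Hp Out always) (Pop Idx))))"

definition lookup_tail :: "reg com" where
  "lookup_tail = Seq lookup_loop (Seq seek (Seq get_clos (mv Out Hp always)))"

definition var_step :: "reg com" where
  "var_step = Seq (Pop TskP) (Seq (mv TskP Idx (\<lambda>x. x = STick)) (Seq (copy_num TskA Adr)
     (Seq (mv Hp Out always) lookup_tail)))"

text \<open>Since \<open>Hp\<close> is reversed, the components of the new entry reach it in reading
  order by a single move each, whereas the called program passes through \<open>Aux\<close> to keep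
  its orientation. \<open>Len\<close> is incremented before it is copied, so it gives the address of
  the new entry.\<close>

definition app_step :: "reg com" where
  "app_step = Seq (Pop TskP) (Seq (Push Hp SLpar) (Seq (Push Hp SLpar) (Seq (mv ValP Hp is_cmd)
     (Seq (Pop ValP) (Seq (Push Hp SComma) (Seq (mv ValA Hp is_bit) (Seq (Pop ValA)
     (Seq (Push Hp SRpar) (Seq (Push Hp SComma) (Seq (mv ValA Hp is_bit) (Seq (Pop ValA)
     (Seq (Push Hp SRpar) (Seq (mv ValP Aux is_cmd) (Seq (Pop ValP) (Seq (Push TskP SSep)
     (Seq (mv Aux TskP always) (Seq (incr Aux Len) (Seq (Push TskA SSep)
     (copy_num Len TskA)))))))))))))))))))"

definition step_prog :: "reg com" where
  "step_prog = Case TskP (\<lambda>x. if x = Some SSep then pop_step else if x = Some SLam then lam_step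
     else if x = Some SVar then var_step else app_step)"

text \<open>Emptiness of the tasks is tested before the countdown, so a run of exactly
  \<open>k\<close> steps is still accepted. \<open>Flag\<close> receives \<open>S1\<close> on
  success, and \<open>STick\<close> from \<open>decr\<close> when the counter is exhausted.\<close>

definition main_loop :: "reg com" where
  "main_loop = While Flag (\<lambda>x. x = None) (Case TskP (\<lambda>x. if x = None then Push Flag S1
     else Seq (decr Aux Flag Cnt) (Case Flag (\<lambda>y. if y = None then step_prog else Skip))))"

definition init_prog :: "reg com" where
  "init_prog = Seq (mv Aux Idx is_bit) (Seq (mv Idx Cnt always) (Seq (Pop Aux)
     (Seq (mv Aux Idx is_cmd) (Seq (Push TskP SSep) (Seq (mv Idx TskP always)
     (Push TskA SSep))))))"

definition emit_prog :: "reg com" where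
  "emit_prog = Seq (mv Hp Out always) (Seq (Push Out SSep) (Seq (Push Out SRpar)
     (Seq (mv ValA Aux is_bit) (Seq (mv Aux Out always) (Seq (Push Out SComma)
     (Seq (mv ValP Aux is_cmd) (Seq (mv Aux Out always) (Push Out SLpar))))))))"

definition heap_prog :: "reg com" where
  "heap_prog = Seq init_prog (Seq main_loop
     (Case Flag (\<lambda>x. if x = Some S1 then emit_prog else Skip)))"

text \<open>The counter is a bit string and not a number because \<open>dec\<close> does not produce
  canonical encodings. The stacks left empty are scratch space that every machine step returns
  empty.\<close>

definition conc :: "sym list \<Rightarrow> hstate \<Rightarrow> reg \<Rightarrow> sym list" where
  "conc ks = (\<lambda>(T, V, H). (\<lambda>_. [])(
     Cnt := ks,
     TskP := concat (map (\<lambda>g. enc_prog (fst g) @ [SSep]) T),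
     TskA := concat (map (\<lambda>g. enc_num (snd g) @ [SSep]) T),
     ValP := concat (map (\<lambda>g. enc_prog (fst g) @ [SSep]) V),
     ValA := concat (map (\<lambda>g. enc_num (snd g) @ [SSep]) V),
     Hp := rev (enc_heap H),
     Len := enc_num (length H)))"

text \<open>The entry at list position \<open>i\<close> has address \<open>i + 1\<close>, so
  \<open>snd (H ! i) \<le> i\<close> says that tail addresses strictly decrease. This bounds the
  number of entries that a lookup can skip.\<close>

fun wf_state :: "nat \<Rightarrow> hstate \<Rightarrow> bool" where
  "wf_state l (T, V, H) \<longleftrightarrow>
     (\<forall>g \<in> set T \<union> set V. length (enc_prog (fst g)) \<le> l \<and> snd g \<le> length H) \<and>
     (\<forall>i < length H. length (enc_prog (fst (fst (H ! i)))) \<le> l \<and>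
        snd (fst (H ! i)) \<le> length H \<and> snd (H ! i) \<le> i)"

lemma lookup_wf:
  assumes "wf_state l (T, V, H)" "lookup H a n = Some g"
  shows "n < a \<and> a \<le> length H \<and> g \<in> fst ` set H"
  using assms(2)
proof (induction n arbitrary: a)
  case (Suc n)
  then have a: "1 \<le> a" "a \<le> length H" "lookup H (snd (H ! (a - 1))) n = Some g"
    by (auto split: if_splits)
  moreover have "snd (H ! (a - 1)) \<le> a - 1"
    using assms(1) a by simp
  ultimately show ?case
    using Suc.IH[OF a(3)] by auto
qed (auto split: if_splits)

text \<open>A step only splits or copies programs. A new entry sits at position
  \<open>length H\<close>, and its tail address is a closure address, hence at most that.\<close>

lemma wf_hs:
  assumes "hs \<sigma> \<sigma>'" "wf_state l \<sigma>"
  shows "wf_state l \<sigma>'"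
  using assms
proof (cases rule: hs.cases)
  case (hs_Var H a n g P T V)
  have "g \<in> fst ` set H"
    using lookup_wf assms(2) hs_Var by metis
  then obtain i where "i < length H" "g = fst (H ! i)"
    by (auto simp: in_set_conv_nth)
  then show ?thesis
    using assms(2) hs_Var by auto
qed (auto simp: nth_append less_Suc_eq intro: le_SucI)

lemma length_enc_entry:
  "length (enc_entry ((P, a), b)) = length (enc_prog P) + length (enc_num a) + length (enc_num b) + 6"
  by (simp add: enc_entry_def enc_clos_def)

lemma enc_heap_simps [simp]:
  "enc_heap [] = []" "enc_heap (e # H) = enc_entry e @ enc_heap H"
  "enc_heap (H @ H') = enc_heap H @ enc_heap H'"
  by (simp_all add: enc_heap_def)

text \<open>\<open>2 * n\<close> bounds the two binary addresses by their values; 6 counts the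
  parentheses and commas of an entry.\<close>

lemma length_enc_heap:
  assumes "\<forall>e \<in> set H. length (enc_prog (fst (fst e))) \<le> l \<and> snd (fst e) \<le> n \<and> snd e \<le> n"
  shows "length (enc_heap H) \<le> length H * (l + 2 * n + 6)"
  using assms
proof (induction H)
  case (Cons e H)
  obtain P a b where e: "e = ((P, a), b)"
    by (metis prod.collapse)
  have "length (enc_entry e) \<le> l + 2 * n + 6"
    using Cons.prems length_enc_num[of a] length_enc_num[of b] by (simp add: e length_enc_entry)
  then show ?case
    using Cons by simp
qed simp

lemma wf_length_enc_heap:
  assumes "wf_state l (T, V, H)" "length H \<le> n"
  shows "length (enc_heap H) \<le> n * (l + 2 * n + 6)"
proof -
  have "length (enc_heap H) \<le> length H * (l + 2 * n + 6)"
    using assms by (intro length_enc_heap) (fastforce simp: in_set_conv_nth)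
  also have "\<dots> \<le> n * (l + 2 * n + 6)"
    using assms(2) by (rule mult_le_mono1)
  finally show ?thesis .
qed

section \<open>Effect and running time of one heap machine step\<close>

lemma wp_copy_num:
  assumes "i \<noteq> Aux" "j \<noteq> Aux" "i \<noteq> j" "s Aux = []"
  shows "wp (copy_num i j) s t Q = Q (s(j := takeWhile is_bit (s i) @ s j))
    (t + (15 * length (takeWhile is_bit (s i)) + 3))"
  using assms by (simp add: copy_num_def) (rule arg_cong2[where f = Q]; simp add: fun_eq_iff)

lemma wp_eq: "wp c s' t' Q \<Longrightarrow> s = s' \<Longrightarrow> t = t' \<Longrightarrow> wp c s t Q"
  by simp

lemma wp_lam_loop_plain1:
  assumes "x \<noteq> SLam" "x \<noteq> SRet" "s TskP = x # r" "s Flag \<noteq> []"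
    and "wp lam_loop (s(TskP := r, Aux := x # s Aux)) (t + 7) Q"
  shows "wp lam_loop s t Q"
proof -
  obtain f fs where f: "s Flag = f # fs"
    using assms(4) by (cases "s Flag") auto
  show ?thesis
    unfolding lam_loop_def
    by (subst wp_While, simp add: f assms(1-3))
      (rule wp_eq[OF assms(5)[unfolded lam_loop_def]]; simp)
qed

lemma wp_lam_loop_SLam:
  assumes "s TskP = SLam # r" "s Flag \<noteq> []"
    and "wp lam_loop (s(TskP := r, Aux := SLam # s Aux, Flag := STick # s Flag)) (t + 10) Q"
  shows "wp lam_loop s t Q"
proof -
  obtain f fs where f: "s Flag = f # fs"
    using assms(2) by (cases "s Flag") auto
  show ?thesis
    unfolding lam_loop_def
    by (subst wp_While, simp add: f assms(1))
      (rule wp_eq[OF assms(3)[unfolded lam_loop_def]]; simp add: f fun_eq_iff)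
qed

lemma wp_lam_loop_SRet:
  assumes "s TskP = SRet # r" "s Flag = x # fs" "fs \<noteq> []"
    and "wp lam_loop (s(TskP := r, Aux := SRet # s Aux, Flag := fs)) (t + 10) Q"
  shows "wp lam_loop s t Q"
proof -
  obtain f fs' where f: "fs = f # fs'"
    using assms(3) by (cases fs) auto
  show ?thesis
    unfolding lam_loop_def
    by (subst wp_While, simp add: f assms(1,2))
      (rule wp_eq[OF assms(4)[unfolded lam_loop_def]]; simp add: f fun_eq_iff)
qed

lemma wp_lam_loop_ticks:
  assumes "s TskP = replicate n STick @ r" "s Flag \<noteq> []"
    and "wp lam_loop (s(TskP := r, Aux := replicate n STick @ s Aux)) (t + 7 * n) Q"
  shows "wp lam_loop s t Q"
  using assms
proof (induction n arbitrary: s t)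
  case 0
  show ?case
    by (rule wp_eq[OF "0.prems"(3)]) (use "0.prems"(1) in \<open>simp_all add: fun_eq_iff\<close>)
next
  case (Suc n)
  show ?case
  proof (rule wp_lam_loop_plain1[of STick])
    show "s TskP = STick # replicate n STick @ r"
      using Suc.prems(1) by simp
    show "wp lam_loop (s(TskP := replicate n STick @ r, Aux := STick # s Aux)) (t + 7) Q"
    proof (rule Suc.IH)
      show "wp lam_loop (s(TskP := replicate n STick @ r, Aux := STick # s Aux,
          TskP := r, Aux := replicate n STick @ (s(TskP := replicate n STick @ r, Aux := STick # s Aux)) Aux))
          (t + 7 + 7 * n) Q"
        by (rule wp_eq[OF Suc.prems(3)]) (simp_all add: fun_eq_iff replicate_app_Cons_same)
    qed (use Suc.prems(2) in simp_all)
  qed (use Suc.prems(2) in simp_all)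
qed

text \<open>The code of a term is balanced: every \<open>SRet\<close> in it closes an
  \<open>SLam\<close> in it, so a nonempty \<open>Flag\<close> never runs empty inside and has its
  old value afterwards. The factor 10 is the dearer of the two costs per symbol, 7 and 10.\<close>

lemma wp_lam_loop_gamma:
  assumes "s TskP = enc_prog (gamma u) @ r" "s Flag \<noteq> []"
    and "\<And>t'. t' \<le> t + 10 * length (enc_prog (gamma u)) \<Longrightarrow>
      wp lam_loop (s(TskP := r, Aux := rev (enc_prog (gamma u)) @ s Aux)) t' Q"
  shows "wp lam_loop s t Q"
  using assms
proof (induction u arbitrary: s t r)
  case (Var n)
  show ?case
  proof (rule wp_lam_loop_plain1[of SVar])
    let ?s = "s(TskP := replicate n STick @ r, Aux := SVar # s Aux)"
    have "wp lam_loop (s(TskP := r, Aux := rev (enc_prog (gamma (Var n))) @ s Aux)) (t + 7 + 7 * n) Q"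
      by (rule Var.prems(3)) simp
    then have "wp lam_loop (?s(TskP := r, Aux := replicate n STick @ ?s Aux)) (t + 7 + 7 * n) Q"
      by (rule wp_eq) (simp_all add: fun_eq_iff)
    then show "wp lam_loop ?s (t + 7) Q"
      by (rule wp_lam_loop_ticks[rotated 2]) (use Var.prems(2) in simp_all)
  qed (use Var.prems(1,2) in simp_all)
next
  case (App u1 u2)
  show ?case
  proof (rule App.IH(1))
    show "s TskP = enc_prog (gamma u1) @ enc_prog (gamma u2) @ SApp # r"
      using App.prems(1) by simp
    show "s Flag \<noteq> []"
      by (rule App.prems(2))
    let ?s1 = "s(TskP := enc_prog (gamma u2) @ SApp # r, Aux := rev (enc_prog (gamma u1)) @ s Aux)"
    fix t1 assume t1: "t1 \<le> t + 10 * length (enc_prog (gamma u1))"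
    show "wp lam_loop ?s1 t1 Q"
    proof (rule App.IH(2))
      let ?s2 = "?s1(TskP := SApp # r, Aux := rev (enc_prog (gamma u2)) @ ?s1 Aux)"
      fix t2 assume t2: "t2 \<le> t1 + 10 * length (enc_prog (gamma u2))"
      show "wp lam_loop ?s2 t2 Q"
      proof (rule wp_lam_loop_plain1[of SApp])
        have "wp lam_loop (s(TskP := r, Aux := rev (enc_prog (gamma (App u1 u2))) @ s Aux)) (t2 + 7) Q"
          by (rule App.prems(3)) (use t1 t2 in simp)
        then show "wp lam_loop (?s2(TskP := r, Aux := SApp # ?s2 Aux)) (t2 + 7) Q"
          by (rule wp_eq) (simp_all add: fun_eq_iff)
      qed (use App.prems(2) in simp_all)
    qed (use App.prems(2) in simp_all)
  qed
next
  case (Lam u)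
  show ?case
  proof (rule wp_lam_loop_SLam)
    show "s TskP = SLam # enc_prog (gamma u) @ SRet # r"
      using Lam.prems(1) by simp
    let ?s1 = "s(TskP := enc_prog (gamma u) @ SRet # r, Aux := SLam # s Aux, Flag := STick # s Flag)"
    show "wp lam_loop ?s1 (t + 10) Q"
    proof (rule Lam.IH[of _ "SRet # r"])
      let ?s2 = "?s1(TskP := SRet # r, Aux := rev (enc_prog (gamma u)) @ ?s1 Aux)"
      fix t2 assume t2: "t2 \<le> t + 10 + 10 * length (enc_prog (gamma u))"
      show "wp lam_loop ?s2 t2 Q"
      proof (rule wp_lam_loop_SRet)
        have "wp lam_loop (s(TskP := r, Aux := rev (enc_prog (gamma (Lam u))) @ s Aux)) (t2 + 10) Q"
          by (rule Lam.prems(3)) (use t2 in simp)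
        then show "wp lam_loop (?s2(TskP := r, Aux := SRet # ?s2 Aux, Flag := s Flag)) (t2 + 10) Q"
          by (rule wp_eq) (simp_all add: fun_eq_iff)
      qed (use Lam.prems(2) in simp_all)
    qed (use Lam.prems(2) in simp_all)
  qed (rule Lam.prems(2))
qed

lemma takeWhile_no_Rpar [simp]:
  "takeWhile (\<lambda>x. x \<noteq> SRpar) (enc_num n @ ys) = enc_num n @ takeWhile (\<lambda>x. x \<noteq> SRpar) ys"
  "dropWhile (\<lambda>x. x \<noteq> SRpar) (enc_num n @ ys) = dropWhile (\<lambda>x. x \<noteq> SRpar) ys"
  "takeWhile (\<lambda>x. x \<noteq> SRpar) (enc_prog P @ ys) = enc_prog P @ takeWhile (\<lambda>x. x \<noteq> SRpar) ys"
  "dropWhile (\<lambda>x. x \<noteq> SRpar) (enc_prog P @ ys) = dropWhile (\<lambda>x. x \<noteq> SRpar) ys"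
proof -
  have "\<forall>x \<in> set (enc_num n). x \<noteq> SRpar" "\<forall>x \<in> set (enc_prog P). x \<noteq> SRpar"
    using is_bit_enc_num[of SRpar n] is_cmd_enc_prog[of SRpar P] by auto
  then show
    "takeWhile (\<lambda>x. x \<noteq> SRpar) (enc_num n @ ys) = enc_num n @ takeWhile (\<lambda>x. x \<noteq> SRpar) ys"
    "dropWhile (\<lambda>x. x \<noteq> SRpar) (enc_num n @ ys) = dropWhile (\<lambda>x. x \<noteq> SRpar) ys"
    "takeWhile (\<lambda>x. x \<noteq> SRpar) (enc_prog P @ ys) = enc_prog P @ takeWhile (\<lambda>x. x \<noteq> SRpar) ys"
    "dropWhile (\<lambda>x. x \<noteq> SRpar) (enc_prog P @ ys) = dropWhile (\<lambda>x. x \<noteq> SRpar) ys"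
    by (simp_all add: takeWhile_all_append)
qed

lemma wp_skip_entry:
  assumes "s Out = enc_entry e @ r"
    and Q: "\<And>t'. t' \<le> t + 6 * length (enc_entry e) + 20 \<Longrightarrow>
      Q (s(Out := r, Hp := rev (enc_entry e) @ s Hp)) t'"
  shows "wp skip_entry s t Q"
proof -
  obtain P d b where e: "e = ((P, d), b)"
    by (metis prod.collapse)
  have Q': "Q s' t'" if "s' = s(Out := r, Hp := rev (enc_entry e) @ s Hp)"
    "t' \<le> t + 6 * length (enc_entry e) + 20" for s' t'
    using that Q by blast
  show ?thesis
    by (simp add: skip_entry_def assms(1) e enc_entry_def enc_clos_def)
      (rule Q'; simp add: fun_eq_iff e enc_entry_def enc_clos_def)
qed

text \<open>The address is described by \<open>binval\<close> because it loses canonical form after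
  the first decrement. Its length stays fixed, which keeps the cost per round uniform.\<close>

lemma wp_seek_loop:
  assumes "s Out = enc_heap H @ r" "binval (s Adr) = length H" "\<forall>x \<in> set (s Adr). is_bit x"
    and "s Flag = []" "s Aux = []"
    and "\<And>t'. t' \<le> t + length H * (11 * length (s Adr) + 60) + 11 * length (s Adr) + 30 +
        6 * length (enc_heap H) \<Longrightarrow>
      Q (s(Out := r, Hp := rev (enc_heap H) @ s Hp, Adr := [], Flag := [STick])) t'"
  shows "wp seek_loop s t Q"
  using assms
proof (induction H arbitrary: s t)
  case Nil
  have Q': "Q s' t'" if "t' \<le> t + 11 * length (s Adr) + 30"
    "s' = s(Out := r, Hp := rev (enc_heap []) @ s Hp, Adr := [], Flag := [STick])" for s' t'
    unfolding that(2) by (rule Nil.prems(6)) (use that(1) in simp)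
  show ?case
    unfolding seek_loop_def
    by (subst wp_While, simp add: Nil.prems(4), rule wp_decr)
      (use Nil.prems in \<open>auto simp: wp_While fun_eq_iff intro!: Q'\<close>)
next
  case (Cons e H)
  have Q': "Q s' t'" if "t' \<le> t + length (e # H) * (11 * length (s Adr) + 60) +
      11 * length (s Adr) + 30 + 6 * length (enc_heap (e # H))"
    "s' = s(Out := r, Hp := rev (enc_heap (e # H)) @ s Hp, Adr := [], Flag := [STick])" for s' t'
    unfolding that(2) by (rule Cons.prems(6)) (use that(1) in simp)
  have bv: "binval (s Adr) \<noteq> 0"
    using Cons.prems(2) by simp
  let ?s1 = "s(Adr := dec (s Adr))"
  let ?s2 = "?s1(Out := enc_heap H @ r, Hp := rev (enc_entry e) @ ?s1 Hp)"
  have loop: "wp seek_loop ?s2 t2 Q"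
    if "t2 \<le> t + 11 * length (s Adr) + 23 + 6 * length (enc_entry e) + 20" for t2
  proof (rule Cons.IH)
    fix t3 assume t3: "t3 \<le> t2 + length H * (11 * length (?s2 Adr) + 60) + 11 * length (?s2 Adr) + 30 +
        6 * length (enc_heap H)"
    show "Q (?s2(Out := r, Hp := rev (enc_heap H) @ ?s2 Hp, Adr := [], Flag := [STick])) t3"
      by (rule Q') (use t3 that in \<open>simp_all add: fun_eq_iff\<close>)
  next
    show "\<forall>x \<in> set (?s2 Adr). is_bit x"
      using is_bit_dec[OF Cons.prems(3)] by simp
  qed (use Cons.prems binval_dec[OF bv] in simp_all)
  have loop': "wp seek_loop s2 t2 Q"
    if "t2 \<le> t + 11 * length (s Adr) + 23 + 6 * length (enc_entry e) + 20"
      "s2 = s(Adr := dec (s Adr), Out := enc_heap H @ r, Hp := rev (enc_entry e) @ s Hp)" for s2 t2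
    using loop[OF that(1)] that(2) by simp
  have "wp (Case Flag (\<lambda>x. if x = None then skip_entry else Skip)) ?s1 t1
      (\<lambda>s' t'. wp seek_loop s' t' Q)" if "t1 \<le> t + 2 + 11 * length (s Adr) + 20" for t1
  proof -
    have "wp skip_entry ?s1 (t1 + 1) (\<lambda>s' t'. wp seek_loop s' t' Q)"
      by (rule wp_skip_entry[of _ e "enc_heap H @ r"])
        (use that Cons.prems(1) in \<open>auto intro!: loop'\<close>)
    then show ?thesis
      using Cons.prems(4) by simp
  qed
  then show ?case
    unfolding seek_loop_def
    by (subst wp_While, simp add: Cons.prems(4) del: wp_Case, intro wp_decr)
      (use Cons.prems(3-5) bv in \<open>simp_all del: wp_Case\<close>)
qed

text \<open>The first summand is the search cost from \<open>wp_seek\<close>; the other two leave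
  slack for moving the heap and copying the components of the entry.\<close>

definition iter_cost :: "heap \<Rightarrow> nat" where
  "iter_cost H = length H * (11 * length H + 71) + 40 * length (enc_heap H) + 200"

lemma wp_seek:
  assumes H: "H = H1 @ e # H2" and "s Out = enc_heap H" "s Adr = enc_num (Suc (length H1))"
    and "s Flag = []" "s Aux = []" "s Hp = []"
    and Q: "\<And>t'. t' \<le> t + length H * (11 * length H + 71) + 32 + 6 * length (enc_heap H) \<Longrightarrow>
      Q (s(Out := enc_heap H2, Hp := rev (enc_entry e) @ rev (enc_heap H1), Adr := [])) t'"
  shows "wp seek s t Q"
proof -
  have le: "length (s Adr) \<le> Suc (length H1)"
    unfolding assms(3) by (rule length_enc_num)
  have "Suc (length H1) * (11 * length (s Adr) + 60) + 11 * length (s Adr)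
      \<le> Suc (length H1) * (11 * Suc (length H1) + 60) + 11 * Suc (length H1)"
    using le by (intro add_mono mult_le_mono) simp_all
  \<comment> \<open>The final decrement, which finds zero, is charged to the rounds; this raises 60
    to 71.\<close>
  also have "\<dots> = Suc (length H1) * (11 * Suc (length H1) + 71)"
    by (simp add: algebra_simps)
  also have "\<dots> \<le> length H * (11 * length H + 71)"
    by (intro mult_le_mono) (simp_all add: H)
  finally have t: "Suc (length H1) * (11 * length (s Adr) + 60) + 11 * length (s Adr) \<le> \<dots>" .
  have eH: "enc_heap H = enc_heap (H1 @ [e]) @ enc_heap H2"
    by (simp add: H)
  have Q': "Q s' t'" if "t' \<le> t + length H * (11 * length H + 71) + 32 + 6 * length (enc_heap H)"
    "s' = s(Out := enc_heap H2, Hp := rev (enc_entry e) @ rev (enc_heap H1), Adr := [])" for s' t'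
    using that Q by blast
  have "wp seek_loop s (t + 1) (\<lambda>s' t'. wp (Pop Flag) s' t' Q)"
    by (rule wp_seek_loop[of _ "H1 @ [e]" "enc_heap H2"])
      (use assms(2-6) t eH is_bit_enc_num in \<open>auto simp: fun_eq_iff intro!: Q'\<close>)
  then show ?thesis
    by (simp add: seek_def)
qed

lemma wp_lookup_iter:
  assumes "H = H1 @ (g, b) # H2" "s Out = enc_heap H" "s Adr = enc_num (Suc (length H1))"
    and "s Flag = []" "s Aux = []" "s Hp = []" "s Idx = STick # js"
    and Q: "\<And>t'. t' \<le> t + iter_cost H \<Longrightarrow> Q (s(Adr := enc_num b, Idx := js)) t'"
  shows "wp (Seq seek (Seq get_tail (Seq (mv Hp Out always) (Pop Idx)))) s t Q"
proof -
  obtain P d where g: "g = (P, d)"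
    by fastforce
  have eH: "enc_heap H = enc_heap H1 @ enc_entry ((P, d), b) @ enc_heap H2"
    by (simp add: assms(1) g)
  have Q': "Q s' t'" if "t' \<le> t + iter_cost H" "s' = s(Adr := enc_num b, Idx := js)" for s' t'
    using that Q by blast
  have "wp seek s (t + 1) (\<lambda>s' t'. wp (Seq get_tail (Seq (mv Hp Out always) (Pop Idx))) s' t' Q)"
    by (rule wp_seek[OF assms(1-6)])
      (use assms(2-7) in \<open>auto simp: get_tail_def g eH enc_entry_def enc_clos_def iter_cost_def
         fun_eq_iff intro!: Q'\<close>)
  then show ?thesis
    by simp
qed

lemma wp_lookup_final:
  assumes "H = H1 @ ((P, d), b) # H2" "s Out = enc_heap H" "s Adr = enc_num (Suc (length H1))"
    and "s Flag = []" "s Aux = []" "s Hp = []"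
    and Q: "\<And>t'. t' \<le> t + iter_cost H \<Longrightarrow> Q (s(Adr := [], Out := [], Hp := rev (enc_heap H),
      ValP := enc_prog P @ SSep # s ValP, ValA := enc_num d @ SSep # s ValA)) t'"
  shows "wp (Seq seek (Seq get_clos (mv Out Hp always))) s t Q"
proof -
  have eH: "enc_heap H = enc_heap H1 @ enc_entry ((P, d), b) @ enc_heap H2"
    by (simp add: assms(1))
  have Q': "Q s' t'" if "t' \<le> t + iter_cost H" "s' = s(Adr := [], Out := [], Hp := rev (enc_heap H),
      ValP := enc_prog P @ SSep # s ValP, ValA := enc_num d @ SSep # s ValA)" for s' t'
    using that Q by blast
  have "wp seek s (t + 1) (\<lambda>s' t'. wp (Seq get_clos (mv Out Hp always)) s' t' Q)"
    by (rule wp_seek[OF assms(1-6)])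
      (use assms(2-6) in \<open>auto simp: get_clos_def eH enc_entry_def enc_clos_def iter_cost_def
         fun_eq_iff intro!: Q'\<close>)
  then show ?thesis
    by simp
qed

lemma split_nth:
  assumes "1 \<le> a" "a \<le> length H"
  obtains H1 H2 where "H = H1 @ H ! (a - 1) # H2" "a = Suc (length H1)"
  using id_take_nth_drop[of "a - 1" H] assms
  by (metis One_nat_def Suc_pred diff_less_Suc length_take less_eq_Suc_le min.absorb4 not_less_eq_eq)

lemma wp_lookup_tail:
  assumes "lookup H a n = Some (P, d)"
    and "s Out = enc_heap H" "s Adr = enc_num a" "s Idx = replicate n STick"
    and "s Flag = []" "s Aux = []" "s Hp = []"
    and Q: "\<And>t'. t' \<le> t + Suc n * (iter_cost H + 10) \<Longrightarrow>
      Q (s(Adr := [], Idx := [], Out := [], Hp := rev (enc_heap H),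
        ValP := enc_prog P @ SSep # s ValP, ValA := enc_num d @ SSep # s ValA)) t'"
  shows "wp lookup_tail s t Q"
proof -
  let ?fin = "Seq seek (Seq get_clos (mv Out Hp always))"
  let ?g = "\<lambda>s. s(Adr := [], Idx := [], Out := [], Hp := rev (enc_heap H),
      ValP := enc_prog P @ SSep # s ValP, ValA := enc_num d @ SSep # s ValA)"
  \<comment> \<open>The final round is part of the postcondition, so that \<open>Suc n\<close>
    rounds are counted by one induction. The gap between 5 here and 10 in the claim pays for the
    remaining overhead.\<close>
  have loop: "wp lookup_loop s t (\<lambda>s' t'. wp ?fin s' t' Q)"
    if "lookup H a n = Some (P, d)" "s Out = enc_heap H" "s Adr = enc_num a"
      "s Idx = replicate n STick" "s Flag = []" "s Aux = []" "s Hp = []"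
      "\<And>t'. t' \<le> t + Suc n * (iter_cost H + 5) \<Longrightarrow> Q (?g s) t'" for s t
    using that
  proof (induction n arbitrary: s t a)
    case 0
    then have a: "1 \<le> a" "a \<le> length H" "fst (H ! (a - 1)) = (P, d)"
      by (auto split: if_splits)
    obtain H1 H2 where H: "H = H1 @ H ! (a - 1) # H2" "a = Suc (length H1)"
      using split_nth[OF a(1,2)] .
    obtain b where b: "H ! (a - 1) = ((P, d), b)"
      using a(3) by (metis prod.collapse)
    have "wp ?fin s (t + 1) Q"
    proof (rule wp_lookup_final[of H H1 P d b H2])
      fix t' assume t': "t' \<le> t + 1 + iter_cost H"
      have "Q (?g s) t'"
        by (rule "0.prems"(8)) (use t' in simp)
      moreover have "?g s = s(Adr := [], Out := [], Hp := rev (enc_heap H),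
          ValP := enc_prog P @ SSep # s ValP, ValA := enc_num d @ SSep # s ValA)"
        using "0.prems"(4) by (simp add: fun_eq_iff)
      ultimately show "Q (s(Adr := [], Out := [], Hp := rev (enc_heap H),
          ValP := enc_prog P @ SSep # s ValP, ValA := enc_num d @ SSep # s ValA)) t'"
        by (simp only:)
    qed (use "0.prems" H b in simp_all)
    then show ?case
      using "0.prems"(4) unfolding lookup_loop_def by (subst wp_While) simp
  next
    case (Suc n)
    then have a: "1 \<le> a" "a \<le> length H" "lookup H (snd (H ! (a - 1))) n = Some (P, d)"
      by (auto split: if_splits)
    obtain H1 H2 where H: "H = H1 @ H ! (a - 1) # H2" "a = Suc (length H1)"
      using split_nth[OF a(1,2)] .
    obtain g b where b: "H ! (a - 1) = (g, b)"
      by fastforce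
    let ?s = "s(Adr := enc_num b, Idx := replicate n STick)"
    have "wp (Seq seek (Seq get_tail (Seq (mv Hp Out always) (Pop Idx)))) s (t + 1)
        (\<lambda>s' t'. wp lookup_loop s' t' (\<lambda>s' t'. wp ?fin s' t' Q))"
    proof (rule wp_lookup_iter[of H H1 g b H2])
      fix t1 assume t1: "t1 \<le> t + 1 + iter_cost H"
      show "wp lookup_loop ?s t1 (\<lambda>s' t'. wp ?fin s' t' Q)"
      proof (rule Suc.IH[of b])
        fix t2 assume t2: "t2 \<le> t1 + Suc n * (iter_cost H + 5)"
        have "Q (?g s) t2"
          by (rule Suc.prems(8)) (use t1 t2 in simp)
        moreover have "?g s = ?g ?s"
          by (simp add: fun_eq_iff)
        ultimately show "Q (?g ?s) t2"
          by (simp only:)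
      qed (use Suc.prems a b in simp_all)
    qed (use Suc.prems H b in simp_all)
    then show ?case
      using Suc.prems(4) unfolding lookup_loop_def by (subst wp_While) simp
  qed
  have "wp lookup_loop s (t + 1) (\<lambda>s' t'. wp ?fin s' t' Q)"
    by (rule loop[OF assms(1-7)], rule Q) (simp add: distrib_left)
  then show ?thesis
    unfolding lookup_tail_def wp_Seq[of lookup_loop] .
qed

lemma conc_simps [simp]:
  "conc ks (T, V, H) Aux = []" "conc ks (T, V, H) Out = []" "conc ks (T, V, H) Cnt = ks"
  "conc ks (T, V, H) Flag = []"
  "conc ks (T, V, H) TskP = concat (map (\<lambda>g. enc_prog (fst g) @ [SSep]) T)"
  "conc ks (T, V, H) TskA = concat (map (\<lambda>g. enc_num (snd g) @ [SSep]) T)"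
  "conc ks (T, V, H) ValP = concat (map (\<lambda>g. enc_prog (fst g) @ [SSep]) V)"
  "conc ks (T, V, H) ValA = concat (map (\<lambda>g. enc_num (snd g) @ [SSep]) V)"
  "conc ks (T, V, H) Hp = rev (enc_heap H)" "conc ks (T, V, H) Len = enc_num (length H)"
  "conc ks (T, V, H) Adr = []" "conc ks (T, V, H) Idx = []"
  by (simp_all add: conc_def)

text \<open>Extensionality restricted to abstract states; together with \<open>all_reg_iff\<close>
  it splits an equality of states into twelve equations.\<close>

lemma fun_eq_conc_iff: "s = conc ks \<sigma> \<longleftrightarrow> (\<forall>r. s r = conc ks \<sigma> r)"
  by (rule fun_eq_iff)

lemma all_reg_iff: "(\<forall>r. P r) \<longleftrightarrow> P Aux \<and> P Out \<and> P Cnt \<and> P Flag \<and> P TskP \<and> P TskA \<and>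
    P ValP \<and> P ValA \<and> P Hp \<and> P Len \<and> P Adr \<and> P Idx"
  (is "_ \<longleftrightarrow> ?all")
proof -
  have "P r" if ?all for r
    using that by (cases r) simp_all
  then show ?thesis by blast
qed

lemma wp_lam_loop_end:
  assumes "s TskP = SRet # r" "s Flag = [x]"
    and "Q (s(TskP := r, Flag := [])) (t + 7)"
  shows "wp lam_loop s t Q"
proof -
  have Q': "Q s' t'" if "s' = s(TskP := r, Flag := [])" "t' = t + 7" for s' t'
    using that assms(3) by simp
  show ?thesis
    unfolding lam_loop_def
    by (subst wp_While, simp add: assms(1,2), subst wp_While, simp)
      (rule Q'; simp add: fun_eq_iff)
qed

text \<open>The summands bound the at most \<open>Suc n\<close> rounds of a lookup, the moves of
  single programs and addresses, and the transfer of the heap to \<open>Out\<close>.\<close>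

definition step_cost :: "nat \<Rightarrow> nat \<Rightarrow> nat" where
  "step_cost l n = Suc n * (n * (11 * n + 71) + 40 * (n * (l + 2 * n + 6)) + 210) + 100 * (l + n + 2)
     + 6 * (n * (l + 2 * n + 6))"

lemma step_cost_ge: "100 * (l + n + 2) \<le> step_cost l n"
  unfolding step_cost_def by (rule trans_le_add1[OF le_add2])

lemma iter_cost_le:
  assumes "wf_state l (T, V, H)" "length H \<le> n"
  shows "iter_cost H \<le> n * (11 * n + 71) + 40 * (n * (l + 2 * n + 6)) + 200"
proof -
  have "length H * (11 * length H + 71) \<le> n * (11 * n + 71)"
    using assms(2) by (intro mult_le_mono) simp_all
  then show ?thesis
    using wf_length_enc_heap[OF assms] by (simp add: iter_cost_def)
qed

text \<open>No encoded program begins with a tick, as \<open>SVar\<close> precedes the ticks of an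
  index. Hence the unary index ends unambiguously where the rest of the program starts.\<close>

lemma takeWhile_ticks [simp]:
  "takeWhile (\<lambda>x. x = STick) (replicate n STick @ enc_prog P @ SSep # r) = replicate n STick"
  "dropWhile (\<lambda>x. x = STick) (replicate n STick @ enc_prog P @ SSep # r) = enc_prog P @ SSep # r"
proof -
  obtain x xs where "enc_prog P @ SSep # r = x # xs" "x \<noteq> STick"
  proof (cases P)
    case (Cons c P')
    then show thesis
      using that by (cases c) auto
  qed (use that in auto)
  then show
    "takeWhile (\<lambda>x. x = STick) (replicate n STick @ enc_prog P @ SSep # r) = replicate n STick"
    "dropWhile (\<lambda>x. x = STick) (replicate n STick @ enc_prog P @ SSep # r) = enc_prog P @ SSep # r"
    by (simp_all add: takeWhile_all_append)
qed

lemma wp_step_prog: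
  assumes "hs \<sigma> \<sigma>'" "wf_state l \<sigma>" "length (snd (snd \<sigma>)) \<le> n"
    and Q: "\<And>t'. t' \<le> t + step_cost l n \<Longrightarrow> Q (conc ks \<sigma>') t'"
  shows "wp step_prog (conc ks \<sigma>) t Q"
proof -
  have Q': "Q s' t'" if "t' \<le> t + step_cost l n" "s' = conc ks \<sigma>'" for s' t'
    using that Q by blast
  show ?thesis
    using assms(1)
  proof (cases rule: hs.cases)
    case (hs_Pop a T V H)
    have "length (enc_num a) \<le> n"
      using length_enc_num[of a] assms(2,3) hs_Pop(1) by simp
    then show ?thesis
      unfolding hs_Pop(1)
      by (simp add: step_prog_def pop_step_def)
        (rule Q'; use step_cost_ge[of l n] in \<open>simp add: hs_Pop(2) fun_eq_conc_iff all_reg_iff\<close>)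
  next
    case (hs_Lam u P a T V H)
    have a: "length (enc_num a) \<le> n"
      using length_enc_num[of a] assms(2,3) hs_Lam(1) by simp
    have u: "length (enc_prog (gamma u)) \<le> l"
      using assms(2) hs_Lam(1) by simp
    show ?thesis
      unfolding hs_Lam(1)
      apply (simp add: step_prog_def lam_step_def)
      apply (rule wp_lam_loop_gamma[of _ u])
        apply simp
       apply simp
      apply (rule wp_lam_loop_end)
        apply simp
       apply simp
      apply (simp add: wp_copy_num)
      apply (rule Q')
      using a u step_cost_ge[of l n]
       apply (simp_all add: hs_Lam(2) fun_eq_conc_iff all_reg_iff)
      done
  next
    case (hs_Var H a m g P T V)
    obtain P' d where g: "g = (P', d)"
      by fastforce
    have wf: "wf_state l ((VarC m # P, a) # T, V, H)"
      using assms(2) hs_Var(1) by simp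
    have n: "length H \<le> n"
      using assms(3) hs_Var(1) by simp
    have a: "length (enc_num a) \<le> n"
      using length_enc_num[of a] wf n by simp
    \<comment> \<open>An index that is found is smaller than the address it is looked up from, as
      tail addresses decrease.\<close>
    have m: "Suc m \<le> n"
      using lookup_wf[OF wf hs_Var(3)] n by simp
    have h: "length (enc_heap H) \<le> n * (l + 2 * n + 6)"
      using wf_length_enc_heap[OF wf n] .
    have "Suc m * (iter_cost H + 10) \<le> Suc n * (n * (11 * n + 71) + 40 * (n * (l + 2 * n + 6)) + 210)"
      using iter_cost_le[OF wf n] m by (intro mult_le_mono) simp_all
    moreover have "6 * m + 15 * length (enc_num a) + 20 \<le> 100 * (l + n + 2)"
      using a m by simp
    ultimately have "Suc m * (iter_cost H + 10) + (6 * m + 15 * length (enc_num a) + 20) +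
        6 * length (enc_heap H) \<le> step_cost l n"
      unfolding step_cost_def using h by (intro add_mono mult_le_mono2)
    then have time: "\<And>t'. t' \<le> t0 + Suc m * (iter_cost H + 10) \<Longrightarrow>
        t0 \<le> t + (6 * m + 15 * length (enc_num a) + 20) + 6 * length (enc_heap H) \<Longrightarrow>
        t' \<le> t + step_cost l n" for t0
      by linarith
    show ?thesis
      unfolding hs_Var(1)
      apply (simp add: step_prog_def var_step_def wp_copy_num)
      apply (rule wp_lookup_tail[OF hs_Var(3)[unfolded g]])
            apply simp_all[6]
      apply (rule Q')
       apply (erule time)
       apply simp
      apply (simp add: hs_Var(2) fun_eq_conc_iff all_reg_iff g)
      done
  next
    case (hs_App P a T g Q0 b V H)
    obtain G d where g: "g = (G, d)"
      by fastforce
    have le: "length (enc_prog G) \<le> l" "length (enc_prog Q0) \<le> l"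
      "length (enc_num d) \<le> n" "length (enc_num b) \<le> n" "length (enc_num (length H)) \<le> n"
      "length (enc_num (Suc (length H))) \<le> n + 1"
      using length_enc_num[of d] length_enc_num[of b] length_enc_num[of "length H"]
        length_enc_num[of "Suc (length H)"] assms(2,3) hs_App(1) by (simp_all add: g)
    show ?thesis
      unfolding hs_App(1) g
      apply (simp add: step_prog_def app_step_def)
      apply (rule wp_incr)
        apply simp_all[2]
      apply (simp add: wp_copy_num enc_num_Suc[symmetric])
      apply (rule Q')
      using le step_cost_ge[of l n]
       apply (simp_all add: hs_App(2) fun_eq_conc_iff all_reg_iff g enc_entry_def enc_clos_def)
      done
  qed
qed

section \<open>The main loop and the complete program\<close>

lemma conc_Cnt_upd: "(conc ks \<sigma>)(Cnt := ks') = conc ks' \<sigma>"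
  by (cases \<sigma>) (simp add: fun_eq_conc_iff all_reg_iff)

text \<open>The separator makes even an exhausted program visible, so an empty stack
  \<open>TskP\<close> means that there are no tasks.\<close>

lemma tasks_Cons:
  assumes "T \<noteq> []"
  obtains x xs where "concat (map (\<lambda>g. enc_prog (fst g) @ [SSep]) T) = x # xs"
  using assms that by (cases T; cases "enc_prog (fst (hd T))") auto

lemma wp_main_loop_unfold:
  assumes "s Flag = []" "s TskP = x # xs"
  shows "wp main_loop s t Q = wp (decr Aux Flag Cnt) s (t + 3)
    (\<lambda>s' t'. wp (if s' Flag = [] then step_prog else Skip) s' (t' + 1) (\<lambda>s' t'. wp main_loop s' t' Q))"
proof -
  have "(top_of ys = None) = (ys = [])" for ys :: "sym list"
    by (cases ys) auto
  then show ?thesis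
    unfolding main_loop_def by (subst wp_While) (simp add: assms numeral_eq_Suc)
qed

lemma wp_main_loop_step:
  assumes "hs \<sigma> \<sigma>'" "wf_state l \<sigma>" "length (snd (snd \<sigma>)) \<le> n"
    and "\<forall>x \<in> set ks. is_bit x" "binval ks \<noteq> 0"
    and Q: "\<And>t'. t' \<le> t + (step_cost l n + 11 * length ks + 30) \<Longrightarrow>
      wp main_loop (conc (dec ks) \<sigma>') t' Q"
  shows "wp main_loop (conc ks \<sigma>) t Q"
proof -
  obtain T V H where \<sigma>: "\<sigma> = (T, V, H)"
    by (metis prod.collapse)
  have "T \<noteq> []"
    using hs_tasks_nonempty[OF assms(1)] by (simp add: \<sigma>)
  then obtain x xs where x: "concat (map (\<lambda>g. enc_prog (fst g) @ [SSep]) T) = x # xs"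
    by (rule tasks_Cons)
  have step: "wp step_prog (conc (dec ks) \<sigma>) (t' + 1) (\<lambda>s' t'. wp main_loop s' t' Q)"
    if "t' \<le> t + 3 + 11 * length ks + 20" for t'
    by (rule wp_step_prog[OF assms(1-3)], rule Q) (use that in simp)
  have "wp (decr Aux Flag Cnt) (conc ks \<sigma>) (t + 3) (\<lambda>s' t'.
      wp (if s' Flag = [] then step_prog else Skip) s' (t' + 1) (\<lambda>s' t'. wp main_loop s' t' Q))"
  proof (rule wp_decr)
    fix t' assume t': "t' \<le> t + 3 + 11 * length (conc ks \<sigma> Cnt) + 20"
    show "wp (if ((conc ks \<sigma>)(Cnt := dec (conc ks \<sigma> Cnt))) Flag = [] then step_prog else Skip)
        ((conc ks \<sigma>)(Cnt := dec (conc ks \<sigma> Cnt))) (t' + 1) (\<lambda>s' t'. wp main_loop s' t' Q)"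
      using step[of t'] t' unfolding conc_Cnt_upd by (simp add: \<sigma>)
  qed (use assms(4,5) in \<open>simp_all add: \<sigma>\<close>)
  then show ?thesis
    by (subst wp_main_loop_unfold) (simp_all add: \<sigma> x)
qed

lemma wp_main_loop_fail:
  assumes "fst \<sigma> \<noteq> []" "\<forall>x \<in> set ks. is_bit x" "binval ks = 0"
    and Q: "\<And>s t'. t' \<le> t + 11 * length ks + 30 \<Longrightarrow> s Flag = [STick] \<Longrightarrow> Q s t'"
  shows "wp main_loop (conc ks \<sigma>) t Q"
proof -
  obtain T V H where \<sigma>: "\<sigma> = (T, V, H)"
    by (metis prod.collapse)
  obtain x xs where x: "concat (map (\<lambda>g. enc_prog (fst g) @ [SSep]) T) = x # xs"
    using assms(1) by (auto simp: \<sigma> intro: tasks_Cons)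
  have stop: "wp main_loop s t' Q" if "s Flag = [STick]" "t' \<le> t + 11 * length ks + 29" for s t'
    unfolding main_loop_def by (subst wp_While) (use that in \<open>simp add: Q\<close>)
  have "wp (decr Aux Flag Cnt) (conc ks \<sigma>) (t + 3) (\<lambda>s' t'.
      wp (if s' Flag = [] then step_prog else Skip) s' (t' + 1) (\<lambda>s' t'. wp main_loop s' t' Q))"
    by (rule wp_decr) (use assms(2,3) in \<open>simp_all add: \<sigma> stop\<close>)
  then show ?thesis
    by (subst wp_main_loop_unfold) (simp_all add: \<sigma> x)
qed

lemma wp_main_loop_done:
  assumes "Q ((conc ks ([], V, H))(Flag := [S1])) (t + 5)"
  shows "wp main_loop (conc ks ([], V, H)) t Q"
  using assms unfolding main_loop_def
  by (subst wp_While, simp, subst wp_While) (simp add: numeral_eq_Suc)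

lemma hs_length_heap: "hs \<sigma> \<sigma>' \<Longrightarrow> length (snd (snd \<sigma>')) \<le> Suc (length (snd (snd \<sigma>)))"
  by (auto elim: hs.cases)

lemma hs_steps_invariant:
  "(hs ^^ m) \<sigma> \<sigma>' \<Longrightarrow> wf_state l \<sigma> \<Longrightarrow>
    wf_state l \<sigma>' \<and> length (snd (snd \<sigma>')) \<le> m + length (snd (snd \<sigma>))"
proof (induction m arbitrary: \<sigma>')
  case (Suc m)
  then obtain \<sigma>1 where "(hs ^^ m) \<sigma> \<sigma>1" "hs \<sigma>1 \<sigma>'"
    by (meson relpowp_Suc_E)
  then show ?case
    using Suc.IH[of \<sigma>1] Suc.prems(2) wf_hs[of \<sigma>1 \<sigma>' l] hs_length_heap[of \<sigma>1 \<sigma>'] by simp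
qed simp

text \<open>\<open>n\<close> bounds the heap length throughout the run, because a step adds at most
  one entry; this makes \<open>step_cost l n\<close> a uniform bound for all \<open>m\<close>
  steps.\<close>

lemma wp_main_loop_steps:
  assumes "(hs ^^ m) \<sigma> \<sigma>'" "wf_state l \<sigma>" "length (snd (snd \<sigma>)) + m \<le> n"
    and "\<forall>x \<in> set ks. is_bit x" "m \<le> binval ks"
    and "\<And>ks' t'. t' \<le> t + m * (step_cost l n + 11 * length ks + 30) \<Longrightarrow> binval ks' = binval ks - m \<Longrightarrow>
      \<forall>x \<in> set ks'. is_bit x \<Longrightarrow> length ks' = length ks \<Longrightarrow> wp main_loop (conc ks' \<sigma>') t' Q"
  shows "wp main_loop (conc ks \<sigma>) t Q"
  using assms
proof (induction m arbitrary: \<sigma> ks t)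
  case 0
  have "wp main_loop (conc ks \<sigma>') t Q"
    by (rule "0.prems"(6)) (use "0.prems"(4) in simp_all)
  then show ?case
    using "0.prems"(1) by simp
next
  case (Suc m)
  obtain \<sigma>1 where \<sigma>1: "hs \<sigma> \<sigma>1" "(hs ^^ m) \<sigma>1 \<sigma>'"
    using Suc.prems(1) by (meson relpowp_Suc_E2)
  have bv: "binval ks \<noteq> 0"
    using Suc.prems(5) by simp
  have len: "length (snd (snd \<sigma>)) \<le> n"
    using Suc.prems(3) by simp
  show ?case
  proof (rule wp_main_loop_step[OF \<sigma>1(1) Suc.prems(2) len Suc.prems(4) bv])
    fix t1 assume t1: "t1 \<le> t + (step_cost l n + 11 * length ks + 30)"
    show "wp main_loop (conc (dec ks) \<sigma>1) t1 Q"
    proof (rule Suc.IH[OF \<sigma>1(2) wf_hs[OF \<sigma>1(1) Suc.prems(2)]])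
      show "length (snd (snd \<sigma>1)) + m \<le> n"
        using hs_length_heap[OF \<sigma>1(1)] Suc.prems(3) by simp
      show "\<forall>x \<in> set (dec ks). is_bit x"
        by (rule is_bit_dec[OF Suc.prems(4)])
      show "m \<le> binval (dec ks)"
        using Suc.prems(5) binval_dec[OF bv] by simp
      fix ks' t' assume "t' \<le> t1 + m * (step_cost l n + 11 * length (dec ks) + 30)"
        "binval ks' = binval (dec ks) - m" "\<forall>x \<in> set ks'. is_bit x" "length ks' = length (dec ks)"
      then show "wp main_loop (conc ks' \<sigma>') t' Q"
        using t1 binval_dec[OF bv] by (intro Suc.prems(6)) simp_all
    qed
  qed
qed

lemma wp_init_prog:
  assumes "\<And>t'. t' \<le> t + (12 * length (enc_num k) + 12 * length (enc_prog P) + 30) \<Longrightarrow>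
    Q (conc (enc_num k) ([(P, 0)], [], [])) t'"
  shows "wp init_prog ((\<lambda>_. [])(Aux := enc_num k @ SSep # enc_prog P)) t Q"
proof -
  have Q': "Q s' t'" if "t' \<le> t + (12 * length (enc_num k) + 12 * length (enc_prog P) + 30)"
    "s' = conc (enc_num k) ([(P, 0)], [], [])" for s' t'
    using that assms by blast
  show ?thesis
    by (simp add: init_prog_def) (rule Q'; simp add: fun_eq_conc_iff all_reg_iff)
qed

lemma wp_emit_prog:
  assumes "s ValP = enc_prog (fst g) @ [SSep]" "s ValA = enc_num (snd g) @ [SSep]"
    "s Hp = rev (enc_heap H)" "s Aux = []" "s Out = []"
    and Q: "\<And>s' t'. t' \<le> t + (6 * length (enc_heap H) + 12 * length (enc_num (snd g)) +
        12 * length (enc_prog (fst g)) + 30) \<Longrightarrow>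
      s' Out = enc_clos g @ [SSep] @ enc_heap H \<Longrightarrow> s' Flag = s Flag \<Longrightarrow> Q s' t'"
  shows "wp emit_prog s t Q"
  by (simp add: emit_prog_def assms(1-5)) (rule Q; simp add: enc_clos_def)

text \<open>Beyond the \<open>k\<close> steps: emitting the heap, moving a program of length at most
  \<open>l\<close> at input and at output (12 each), and moving the counter and the output
  address.\<close>

definition total_cost :: "nat \<Rightarrow> nat \<Rightarrow> nat" where
  "total_cost l k = k * (step_cost l k + 11 * k + 30) + 6 * (k * (l + 2 * k + 6)) + 24 * l + 40 * k + 200"

lemma initial_wf: "wf_state (length (enc_prog P)) ([(P, 0)], [], [])"
  by simp

lemma wp_heap_prog_accept:
  assumes run: "(hs ^^ m) ([(P, 0)], [], []) ([], [g], H)" and "m \<le> k"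
  shows "wp heap_prog ((\<lambda>_. [])(Aux := enc_num k @ SSep # enc_prog P)) 0
    (\<lambda>s' t'. t' \<le> total_cost (length (enc_prog P)) k \<and> s' Flag = [S1] \<and>
      s' Out = enc_clos g @ [SSep] @ enc_heap H)"
proof -
  let ?l = "length (enc_prog P)"
  let ?Q = "\<lambda>s' t'. t' \<le> total_cost ?l k \<and> s' Flag = [S1] \<and> s' Out = enc_clos g @ [SSep] @ enc_heap H"
  let ?fin = "Case Flag (\<lambda>x. if x = Some S1 then emit_prog else Skip)"
  have wf: "wf_state ?l ([], [g], H)" "length H \<le> k"
    using hs_steps_invariant[OF run initial_wf] \<open>m \<le> k\<close> by auto
  have lk: "length (enc_num k) \<le> k"
    by (rule length_enc_num)
  have g: "length (enc_prog (fst g)) \<le> ?l" "length (enc_num (snd g)) \<le> k"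
    using wf length_enc_num[of "snd g"] by auto
  have h: "length (enc_heap H) \<le> k * (?l + 2 * k + 6)"
    by (rule wf_length_enc_heap[OF wf])
  have "m * (step_cost ?l k + 11 * length (enc_num k) + 30) \<le> k * (step_cost ?l k + 11 * k + 30)"
    using \<open>m \<le> k\<close> lk by (intro mult_le_mono) simp_all
  then have time: "t3 \<le> total_cost ?l k"
    if "t1 \<le> 1 + (12 * length (enc_num k) + 12 * ?l + 30)"
      "t2 \<le> t1 + 1 + m * (step_cost ?l k + 11 * length (enc_num k) + 30)"
      "t3 \<le> t2 + 6 + (6 * length (enc_heap H) + 12 * length (enc_num (snd g)) +
        12 * length (enc_prog (fst g)) + 30)" for t1 t2 t3
    using that lk g h unfolding total_cost_def by linarith
  have "wp init_prog ((\<lambda>_. [])(Aux := enc_num k @ SSep # enc_prog P)) 1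
    (\<lambda>s' t'. wp main_loop s' (t' + 1) (\<lambda>s' t'. wp ?fin s' t' ?Q))"
  proof (rule wp_init_prog)
    fix t1 assume t1: "t1 \<le> 1 + (12 * length (enc_num k) + 12 * ?l + 30)"
    show "wp main_loop (conc (enc_num k) ([(P, 0)], [], [])) (t1 + 1) (\<lambda>s' t'. wp ?fin s' t' ?Q)"
    proof (rule wp_main_loop_steps[OF run initial_wf, of k])
      fix ks' t2 assume t2: "t2 \<le> t1 + 1 + m * (step_cost ?l k + 11 * length (enc_num k) + 30)"
      let ?s = "(conc ks' ([], [g], H))(Flag := [S1])"
      have "wp emit_prog ?s (t2 + 6) ?Q"
      proof (rule wp_emit_prog[of _ g H])
        fix s' t3 assume "t3 \<le> t2 + 6 + (6 * length (enc_heap H) + 12 * length (enc_num (snd g)) +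
            12 * length (enc_prog (fst g)) + 30)"
          "s' Out = enc_clos g @ [SSep] @ enc_heap H" "s' Flag = ?s Flag"
        then show "?Q s' t3"
          using time[OF t1 t2] by simp
      qed simp_all
      then have "wp ?fin ?s (t2 + 5) ?Q"
        by (simp add: numeral_eq_Suc)
      then show "wp main_loop (conc ks' ([], [g], H)) t2 (\<lambda>s' t'. wp ?fin s' t' ?Q)"
        by (rule wp_main_loop_done)
    qed (use is_bit_enc_num \<open>m \<le> k\<close> in auto)
  qed
  then show ?thesis
    unfolding heap_prog_def wp_Seq add_0 .
qed

lemma wp_heap_prog_reject:
  assumes run: "(hs ^^ k) ([(P, 0)], [], []) \<sigma>" and "fst \<sigma> \<noteq> []"
  shows "wp heap_prog ((\<lambda>_. [])(Aux := enc_num k @ SSep # enc_prog P)) 0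
    (\<lambda>s' t'. t' \<le> total_cost (length (enc_prog P)) k \<and> s' Flag = [STick])"
proof -
  let ?l = "length (enc_prog P)"
  let ?Q = "\<lambda>s' t'. t' \<le> total_cost ?l k \<and> s' Flag = [STick]"
  let ?fin = "Case Flag (\<lambda>x. if x = Some S1 then emit_prog else Skip)"
  have lk: "length (enc_num k) \<le> k"
    by (rule length_enc_num)
  have "k * (step_cost ?l k + 11 * length (enc_num k) + 30) \<le> k * (step_cost ?l k + 11 * k + 30)"
    using lk by (intro mult_le_mono) simp_all
  then have time: "t3 + 2 \<le> total_cost ?l k"
    if "t1 \<le> 1 + (12 * length (enc_num k) + 12 * ?l + 30)"
      "t2 \<le> t1 + 1 + k * (step_cost ?l k + 11 * length (enc_num k) + 30)"
      "t3 \<le> t2 + 11 * length (enc_num k) + 30" for t1 t2 t3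
    using that lk unfolding total_cost_def by linarith
  have "wp init_prog ((\<lambda>_. [])(Aux := enc_num k @ SSep # enc_prog P)) 1
    (\<lambda>s' t'. wp main_loop s' (t' + 1) (\<lambda>s' t'. wp ?fin s' t' ?Q))"
  proof (rule wp_init_prog)
    fix t1 assume t1: "t1 \<le> 1 + (12 * length (enc_num k) + 12 * ?l + 30)"
    show "wp main_loop (conc (enc_num k) ([(P, 0)], [], [])) (t1 + 1) (\<lambda>s' t'. wp ?fin s' t' ?Q)"
    proof (rule wp_main_loop_steps[OF run initial_wf, of k])
      fix ks' t2 assume t2: "t2 \<le> t1 + 1 + k * (step_cost ?l k + 11 * length (enc_num k) + 30)"
        and ks': "binval ks' = binval (enc_num k) - k" "\<forall>x \<in> set ks'. is_bit x"
          "length ks' = length (enc_num k)"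
      show "wp main_loop (conc ks' \<sigma>) t2 (\<lambda>s' t'. wp ?fin s' t' ?Q)"
      proof (rule wp_main_loop_fail[OF \<open>fst \<sigma> \<noteq> []\<close> ks'(2)])
        fix s :: "reg \<Rightarrow> sym list" and t3
        assume "t3 \<le> t2 + 11 * length ks' + 30" "s Flag = [STick]"
        then show "wp ?fin s t3 ?Q"
          using time[OF t1 t2, of t3] ks'(3) by simp
      qed (use ks'(1) in simp)
    qed (use is_bit_enc_num in auto)
  qed
  then show ?thesis
    unfolding heap_prog_def wp_Seq add_0 .
qed

section \<open>Polynomial bounds and the final machine\<close>

lemma total_cost_le:
  assumes "l \<le> 2 * S" "1 \<le> S"
  shows "total_cost l k \<le> 2500 * (S * (k + 1) ^ 4)"
proof -
  \<comment> \<open>Every quantity is bounded by a multiple of \<open>S * M ^ i\<close>, so that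
    \<open>S\<close> stays linear. An encoded heap has \<open>i = 2\<close>, the rounds of a lookup
    give 3, the \<open>k\<close> steps give 4. The constants are
    \<open>82 + 40 * 10 + 210 = 692\<close>, then \<open>692 + 500 + 60 = 1252\<close>, then
    \<open>1252 + 11 + 30 = 1293\<close>; 2500 leaves slack.\<close>
  define M where "M = k + 1"
  have kM: "k \<le> M" "1 \<le> M"
    by (simp_all add: M_def)
  have SM: "S \<le> S * M" "M \<le> S * M" "1 \<le> S * M"
    using kM assms(2) by simp_all
  have "k * (l + 2 * k + 6) \<le> M * (10 * (S * M))"
    using SM kM assms by (intro mult_le_mono) linarith+
  then have a: "k * (l + 2 * k + 6) \<le> 10 * (S * M ^ 2)"
    by (simp add: power2_eq_square ac_simps)
  have "k * (11 * k + 71) \<le> M * (82 * (S * M))"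
    using SM kM by (intro mult_le_mono) linarith+
  then have b: "k * (11 * k + 71) \<le> 82 * (S * M ^ 2)"
    by (simp add: power2_eq_square ac_simps)
  have pow: "1 \<le> S * M ^ i" "S * M ^ i \<le> S * M ^ Suc i" for i
    using kM assms(2) by simp_all
  have "Suc k * (k * (11 * k + 71) + 40 * (k * (l + 2 * k + 6)) + 210) \<le> M * (692 * (S * M ^ 2))"
    using a b pow(1)[of 2] by (intro mult_le_mono) (simp add: M_def, linarith)
  then have c: "Suc k * (k * (11 * k + 71) + 40 * (k * (l + 2 * k + 6)) + 210) \<le> 692 * (S * M ^ 3)"
    by (simp add: power2_eq_square power3_eq_cube ac_simps)
  have SM2: "S * M \<le> S * M ^ 2" "S * M ^ 2 \<le> S * M ^ 3" "S * M ^ 3 \<le> S * M ^ 4"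
    using pow(2)[of 1] pow(2)[of 2] pow(2)[of 3] by (simp_all add: numeral_eq_Suc)
  have "l + k + 2 \<le> 5 * (S * M)"
    using SM kM assms by linarith
  then have "100 * (l + k + 2) \<le> 500 * (S * M)"
    by simp
  then have "step_cost l k \<le> 1252 * (S * M ^ 3)"
    unfolding step_cost_def using a c SM2 by linarith
  then have "k * (step_cost l k + 11 * k + 30) \<le> M * (1293 * (S * M ^ 3))"
    using kM SM SM2 by (intro mult_le_mono) linarith+
  moreover have pow4: "M ^ 4 = M * M ^ 3"
    by (simp flip: power_Suc)
  ultimately have "k * (step_cost l k + 11 * k + 30) \<le> 1293 * (S * M ^ 4)"
    by (simp only: pow4 ac_simps)
  then have "total_cost l k \<le> 2500 * (S * M ^ 4)"
    unfolding total_cost_def using a SM SM2 kM assms by linarith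
  then show ?thesis
    by (simp add: M_def)
qed

fun reg_index :: "reg \<Rightarrow> nat" where
  "reg_index Aux = 0" | "reg_index Out = 1" | "reg_index Cnt = 2" | "reg_index Flag = 3"
| "reg_index TskP = 4" | "reg_index TskA = 5" | "reg_index ValP = 6" | "reg_index ValA = 7"
| "reg_index Hp = 8" | "reg_index Len = 9" | "reg_index Adr = 10" | "reg_index Idx = 11"

lemma inj_reg_index: "inj reg_index"
proof (rule injI)
  fix x y show "reg_index x = reg_index y \<Longrightarrow> x = y"
    by (cases x; cases y) auto
qed

lemma range_reg_index: "range reg_index = {..<12}"
proof
  show "range reg_index \<subseteq> {..<12}"
  proof
    fix i assume "i \<in> range reg_index"
    then obtain r where "i = reg_index r"
      by blast
    then show "i \<in> {..<12}"
      by (cases r) simp_all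
  qed
  have "reg_index ` {Aux, Out, Cnt, Flag, TskP, TskA, ValP, ValA, Hp, Len, Adr, Idx} = {..<12}"
    by (auto simp: numeral_eq_Suc lessThan_Suc)
  then show "{..<12} \<subseteq> range reg_index"
    by blast
qed

text \<open>The factor 2 comes from abstractions, which contribute two symbols but only 1 to the
  size; a unary variable is exactly as long as its size.\<close>

lemma length_enc_prog_gamma: "length (enc_prog (gamma s)) \<le> 2 * tsize s"
  by (induction s) auto

lemma tsize_pos: "1 \<le> tsize s"
  by (cases s) auto

theorem theorem19:
  shows "\<exists>M cT dT cS dS. wf_tm M \<and> 2 \<le> ntapes M \<and>
    (\<forall>k s. closed s \<longrightarrow>
      (\<exists>t c. runs M (init_config M (enc_input k s)) t c \<and>
         t \<le> cT * (tsize s + k + 1) ^ dT \<and>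
         space M (init_config M (enc_input k s)) t \<le> cS * tsize s * (k + 1) ^ dS \<and>
         (\<forall>nf. normal_form s nf \<and> 4 * Time s + 2 \<le> k \<longrightarrow>
            fst c = acc M \<and> (\<exists>H g. contains (snd c ! 1) (enc_output g H) \<and> clos_rep H g nf)) \<and>
         (\<not> (\<exists>nf. normal_form s nf \<and> 4 * Time s + 2 \<le> k) \<longrightarrow> fst c = rej M)))"
proof -
  \<comment> \<open>States are natural numbers, so the finitely many continuations are numbered by
    some injection.\<close>
  obtain e :: "reg com list \<Rightarrow> nat" where inj: "inj_on e (insert [] (conts heap_prog []))"
    using finite_imp_inj_to_nat_seg[of "insert [] (conts heap_prog [])"] finite_conts by auto
  define M where "M = compile e reg_index 12 Flag heap_prog"
  have M: "ntapes M = 12"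
    by (simp add: M_def)
  have main: "\<exists>t c. runs M (init_config M (enc_input k s)) t c \<and>
         t \<le> 2501 * (tsize s + k + 1) ^ 5 \<and>
         space M (init_config M (enc_input k s)) t \<le> 70000 * tsize s * (k + 1) ^ 4 \<and>
         (\<forall>nf. normal_form s nf \<and> 4 * Time s + 2 \<le> k \<longrightarrow>
            fst c = acc M \<and> (\<exists>H g. contains (snd c ! 1) (enc_output g H) \<and> clos_rep H g nf)) \<and>
         (\<not> (\<exists>nf. normal_form s nf \<and> 4 * Time s + 2 \<le> k) \<longrightarrow> fst c = rej M)"
    if closed: "closed s" for k s
  proof -
    let ?s0 = "(\<lambda>_. [])(Aux := enc_num k @ SSep # enc_prog (gamma s))"
    let ?acc = "\<exists>nf. normal_form s nf \<and> 4 * Time s + 2 \<le> k"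
    have input: "enc_input k s = map code (enc_num k @ SSep # enc_prog (gamma s))"
      by (simp add: enc_input_def)
    have "\<exists>n s'. bs heap_prog ?s0 n s' \<and> n \<le> total_cost (length (enc_prog (gamma s))) k \<and>
      (?acc \<longrightarrow> s' Flag = [S1]) \<and> (\<not> ?acc \<longrightarrow> s' Flag = [STick]) \<and>
      (\<forall>nf. normal_form s nf \<and> 4 * Time s + 2 \<le> k \<longrightarrow>
        (\<exists>H g. s' Out = enc_clos g @ [SSep] @ enc_heap H \<and> clos_rep H g nf))"
    proof (cases ?acc)
      case True
      then obtain j nf where nf: "eval s j nf" "4 * j + 2 \<le> k"
        by (auto simp: normal_form_def reduces_in_iff_eval dest: Time_eval)
      have uniq: "nf' = nf" if "normal_form s nf'" for nf'
        using that nf(1) eval_det by (auto simp: normal_form_def reduces_in_iff_eval)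
      obtain g H where gH: "(hs ^^ (4 * j + 2)) ([(gamma s, 0)], [], []) ([], [g], H)" "clos_rep H g nf"
        using hs_terminates[OF closed nf(1)] by blast
      from wp_heap_prog_accept[OF gH(1) nf(2)] show ?thesis
        using True gH(2) uniq unfolding wp_def add_0 by blast
    next
      case False
      obtain \<sigma> where \<sigma>: "(hs ^^ k) ([(gamma s, 0)], [], []) \<sigma>" "fst \<sigma> \<noteq> []"
        using hs_runs_long[OF closed False] by blast
      from wp_heap_prog_reject[OF \<sigma>] show ?thesis
        using False unfolding wp_def add_0 by blast
    qed
    then obtain n s' where n: "bs heap_prog ?s0 n s'"
      "n \<le> total_cost (length (enc_prog (gamma s))) k"
      "?acc \<Longrightarrow> s' Flag = [S1]" "\<not> ?acc \<Longrightarrow> s' Flag = [STick]"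
      "\<forall>nf. normal_form s nf \<and> 4 * Time s + 2 \<le> k \<longrightarrow>
        (\<exists>H g. s' Out = enc_clos g @ [SSep] @ enc_heap H \<and> clos_rep H g nf)"
      by blast
    obtain c where c: "runs M (init_config M (enc_input k s)) (Suc n) c"
      "fst c = (if top_of (s' Flag) = Some S1 then acc M else rej M)"
      "\<forall>r. contains (snd c ! reg_index r) (map code (s' r))"
      using compile_runs[OF inj inj_reg_index range_reg_index reg_index.simps(1) n(1), of Flag]
      unfolding M_def input by blast
    have out: "contains (snd c ! 1) (map code (s' Out))"
      using c(3) by (metis reg_index.simps(2))
    let ?S = "tsize s"
    have pos: "1 \<le> ?S * (k + 1) ^ 4"
      using tsize_pos[of s] by simp
    \<comment> \<open>The verdict step turns 2500 into 2501.\<close>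
    have n': "Suc n \<le> 2501 * (?S * (k + 1) ^ 4)"
      using n(2) total_cost_le[OF length_enc_prog_gamma tsize_pos, of s k] pos by linarith
    have "?S * (k + 1) ^ 4 \<le> (?S + k + 1) * (?S + k + 1) ^ 4"
      by (intro mult_le_mono power_mono) simp_all
    also have "\<dots> = (?S + k + 1) ^ 5"
      by (simp add: numeral_eq_Suc)
    finally have time: "Suc n \<le> 2501 * (?S + k + 1) ^ 5"
      using n' by linarith
    have "k + 1 \<le> (k + 1) ^ 4"
      using self_le_power[of "k + 1" 4] by simp
    then have "?S * (k + 1) \<le> ?S * (k + 1) ^ 4"
      by (rule mult_le_mono2)
    moreover have "k + 1 \<le> ?S * (k + 1)" "?S \<le> ?S * (k + 1)"
      using mult_le_mono1[OF tsize_pos[of s], of "k + 1"] by simp_all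
    moreover have "length (enc_input k s) \<le> k + 1 + 2 * ?S"
      using length_enc_num[of k] length_enc_prog_gamma[of s] by (simp add: input)
    \<comment> \<open>Twelve tapes grow by at most 24 cells per step, giving
      \<open>24 * 2501 = 60024\<close>; the input adds at most 3 times the same product, which 70000
      covers.\<close>
    ultimately have "length (enc_input k s) + Suc n * (2 * Suc (ntapes M - 1)) \<le>
        70000 * (?S * (k + 1) ^ 4)"
      using n' by (simp add: M)
    then have space: "space M (init_config M (enc_input k s)) (Suc n) \<le> 70000 * ?S * (k + 1) ^ 4"
      using space_le_time[of M "enc_input k s" "Suc n"] by linarith
    show ?thesis
    proof (intro exI conjI)
      show "\<forall>nf. normal_form s nf \<and> 4 * Time s + 2 \<le> k \<longrightarrow>
          fst c = acc M \<and> (\<exists>H g. contains (snd c ! 1) (enc_output g H) \<and> clos_rep H g nf)"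
        using n(3,5) c(2) out unfolding enc_output_def by fastforce
      show "\<not> ?acc \<longrightarrow> fst c = rej M"
        using n(4) c(2) by simp
    qed (fact c(1) time space)+
  qed
  have "wf_tm M"
    unfolding M_def by (rule wf_compile[OF inj]) simp
  then show ?thesis
    using main M by (intro exI[of _ M] exI[of _ 2501] exI[of _ 5] exI[of _ 70000] exI[of _ 4]) auto
qed

end
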